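(* Let $\mathbb{K}$ be a field and let $G$ be a Cohen–Macaulay bipartite graph with a leaf $u$. Let $N_G(u)=\{v\}$ with $\deg_G(v)\ge 2$. Then $$\operatorname{depth}(S_{G\setminus u}/I_{G\setminus u})=\operatorname{depth}(S_G/I_G)-1.$$
   Context: Graphs are finite and simple; $G$ is assumed to have no isolated vertices. For a graph $H$ with vertex set $V(H)$ and edge set $E(H)$, $S_H=\mathbb{K}[V(H)]$ is the standard graded polynomial ring over $\mathbb{K}$ whose variables are the vertices of $H$, and $I_H=(uv \mid \{u,v\}\in E(H))\subset S_H$ is the edge ideal. $H$ is called Cohen–Macaulay if $S_H/I_H$ is a Cohen–Macaulay ring. $N_H(v)=\{u \mid \{u,v\}\in E(H)\}$, $\deg_H(v)=|N_H(v)|$, and $v$ is a leaf if $\deg_H(v)=1$. $H\setminus v$ is the induced subgraph of $H$ on $V(H)\setminus\{v\}$. *)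

theory Defs
  imports
    "HOL-Algebra.Algebra"
    "HOL-Library.Poly_Mapping"
    "HOL-Library.Extended_Nat"
begin

section \<open>Finite simple graphs\<close>

record 'v sgraph =
  verts :: "'v set"
  edges :: "'v set set"

definition simple_graph :: "'v sgraph \<Rightarrow> bool" where
  "simple_graph G \<longleftrightarrow>
     finite (verts G) \<and> (\<forall>e\<in>edges G. e \<subseteq> verts G \<and> card e = 2)"

definition nbhd :: "'v sgraph \<Rightarrow> 'v \<Rightarrow> 'v set" where
  "nbhd G v = {u. {u, v} \<in> edges G}"

definition vertex_degree :: "'v sgraph \<Rightarrow> 'v \<Rightarrow> nat" where
  "vertex_degree G v = card (nbhd G v)"

definition leaf :: "'v sgraph \<Rightarrow> 'v \<Rightarrow> bool" where
  "leaf G v \<longleftrightarrow> v \<in> verts G \<and> vertex_degree G v = 1"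

definition no_isolated_vertices :: "'v sgraph \<Rightarrow> bool" where
  "no_isolated_vertices G \<longleftrightarrow> (\<forall>v\<in>verts G. nbhd G v \<noteq> {})"

definition bipartite :: "'v sgraph \<Rightarrow> bool" where
  "bipartite G \<longleftrightarrow>
     (\<exists>A B. A \<union> B = verts G \<and> A \<inter> B = {} \<and>
        (\<forall>e\<in>edges G. \<exists>a\<in>A. \<exists>b\<in>B. e = {a, b}))"

definition del_vertex :: "'v sgraph \<Rightarrow> 'v \<Rightarrow> 'v sgraph" where
  "del_vertex G v =
     \<lparr>verts = verts G - {v}, edges = {e \<in> edges G. e \<subseteq> verts G - {v}}\<rparr>"


section \<open>Depth, height and Cohen--Macaulay rings\<close>

definition regular_element :: "('a, 'm) ring_scheme \<Rightarrow> 'a \<Rightarrow> bool" where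
  "regular_element R a \<longleftrightarrow>
     (\<forall>y\<in>carrier R. a \<otimes>\<^bsub>R\<^esub> y = \<zero>\<^bsub>R\<^esub> \<longrightarrow> y = \<zero>\<^bsub>R\<^esub>)"

text \<open>
  A list \<open>xs = [x\<^sub>1, \<dots>, x\<^sub>n]\<close> is a regular sequence on \<open>R\<close> if every \<open>x\<^sub>i\<close> is a
  non-zero-divisor on \<open>R / (x\<^sub>1, \<dots>, x\<^sub>i\<^sub>-\<^sub>1)\<close> and \<open>R / (x\<^sub>1, \<dots>, x\<^sub>n)\<close> is not zero.
\<close>

definition regular_sequence :: "('a, 'm) ring_scheme \<Rightarrow> 'a list \<Rightarrow> bool" where
  "regular_sequence R xs \<longleftrightarrow>
     set xs \<subseteq> carrier R \<and>
     (\<forall>i<length xs.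
        let J = genideal R (set (take i xs))
        in regular_element (R Quot J) (J +>\<^bsub>R\<^esub> (xs ! i))) \<and>
     genideal R (set xs) \<noteq> carrier R"

text \<open>
  The depth (or grade) of the ideal \<open>P\<close> on the ring \<open>R\<close>. It is a supremum in the
  extended naturals, so that no convention is needed for unbounded lengths (which
  do not occur if \<open>R\<close> is Noetherian).
\<close>

definition depth :: "('a, 'm) ring_scheme \<Rightarrow> 'a set \<Rightarrow> enat" where
  "depth R P = Sup {enat (length xs) | xs. regular_sequence R xs \<and> set xs \<subseteq> P}"

text \<open>The supremum of the lengths \<open>n\<close> of chains \<open>P\<^sub>0 \<subset> \<dots> \<subset> P\<^sub>n = P\<close> of prime ideals.\<close>

definition height :: "('a, 'm) ring_scheme \<Rightarrow> 'a set \<Rightarrow> enat" where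
  "height R P =
     Sup {enat n | n. \<exists>c :: nat \<Rightarrow> 'a set.
       (\<forall>i\<le>n. primeideal (c i) R) \<and> (\<forall>i<n. c i \<subset> c (Suc i)) \<and> c n = P}"

text \<open>
  The definition of a Cohen--Macaulay ring is the one in Eisenbud, \<open>Commutative
  Algebra with a View Toward Algebraic Geometry\<close>, Section 18.2: a Noetherian
  ring in which the depth of every maximal ideal is its codimension (height).
\<close>

definition cohen_macaulay_ring :: "('a, 'm) ring_scheme \<Rightarrow> bool" where
  "cohen_macaulay_ring R \<longleftrightarrow>
     cring R \<and> noetherian_ring R \<and>
     (\<forall>P. maximalideal P R \<longrightarrow> depth R P = height R P)"


section \<open>Edge ideals\<close>

text \<open>
  A monomial is a finitely supported exponent function of type \<open>'v \<Rightarrow>\<^sub>0 nat\<close>, and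
  a polynomial is a finitely supported family of coefficients indexed by monomials.
  The type \<open>(('v \<Rightarrow>\<^sub>0 nat) \<Rightarrow>\<^sub>0 'k)\<close> has all elements of \<open>'v\<close> as variables;
  \<open>\<bbbK>[V]\<close> is carved out of it as the subring of the polynomials in which only
  variables in \<open>V\<close> occur.
\<close>

type_synonym ('v, 'k) mvpoly = "('v \<Rightarrow>\<^sub>0 nat) \<Rightarrow>\<^sub>0 'k"

definition polynomial_ring :: "'v set \<Rightarrow> ('v, 'k::field) mvpoly ring" where
  "polynomial_ring V =
     \<lparr>carrier = {p. \<forall>m\<in>Poly_Mapping.keys p. Poly_Mapping.keys m \<subseteq> V},
      monoid.mult = (*), one = 1, ring.zero = 0, add = (+)\<rparr>"

definition variable :: "'v \<Rightarrow> ('v, 'k::field) mvpoly" where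
  "variable v = Poly_Mapping.single (Poly_Mapping.single v 1) 1"

definition edge_ideal :: "'v sgraph \<Rightarrow> ('v, 'k::field) mvpoly set" where
  "edge_ideal H =
     genideal (polynomial_ring (verts H))
       {variable u * variable v | u v. {u, v} \<in> edges H}"

text \<open>
  The ring \<open>S\<^sub>H / I\<^sub>H\<close>. The first argument names the coefficient field, which cannot
  be inferred from the graph.
\<close>

definition edge_ring :: "'k::field itself \<Rightarrow> 'v sgraph \<Rightarrow> ('v, 'k) mvpoly set ring" where
  "edge_ring K H = polynomial_ring (verts H) Quot edge_ideal H"

text \<open>The graded maximal ideal of \<open>S\<^sub>H / I\<^sub>H\<close>, generated by the residue classes of the vertices.\<close>

definition edge_ring_max_ideal ::
    "'k::field itself \<Rightarrow> 'v sgraph \<Rightarrow> ('v, 'k) mvpoly set set" where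
  "edge_ring_max_ideal K H =
     genideal (edge_ring K H)
       ((\<lambda>v. edge_ideal H +>\<^bsub>polynomial_ring (verts H)\<^esub> variable v) ` verts H)"

text \<open>As usual for standard graded algebras, the depth is taken with respect to the graded maximal ideal.\<close>

definition edge_ring_depth :: "'k::field itself \<Rightarrow> 'v sgraph \<Rightarrow> enat" where
  "edge_ring_depth K H = depth (edge_ring K H) (edge_ring_max_ideal K H)"

definition cohen_macaulay_graph :: "'k::field itself \<Rightarrow> 'v sgraph \<Rightarrow> bool" where
  "cohen_macaulay_graph K H \<longleftrightarrow> cohen_macaulay_ring (edge_ring K H)"

end

theory Submission
  imports Defs
begin

text \<open>
  For a graph \<open>H\<close> with vertex set \<open>V\<close> let \<open>H\<^sub>i\<close> be the Koszul homology of \<open>S / I\<close>, the edge ring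
  of \<open>H\<close>, with respect to the variables. The graded maximal ideal contains a regular sequence of
  length \<open>d\<close> on \<open>S / I\<close> if and only if \<open>H\<^sub>i = 0\<close> for all \<open>i > |V| - d\<close>
  (\<open>acyclic_of_regular_seq\<close>, \<open>regular_seq_of_acyclic\<close>). So bounds on the depth are statements about
  vanishing of Koszul homology, and these behave well under operations on graphs.

  Deleting a vertex lowers the depth by at most one (\<open>depth_del_vertex_ge\<close>). Setting \<open>u = 0\<close> is a
  retraction of the edge ring of \<open>G\<close> onto that of \<open>G \<setminus> u\<close>; applied to the coefficients of a
  bounding chain it shows that vanishing of \<open>H\<^sub>i\<close> passes from \<open>G\<close> to \<open>G \<setminus> u\<close>, while the number
  of variables drops by one.

  If \<open>C\<close> is a minimal vertex cover, then the depth is at most \<open>|V - C|\<close>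
  (\<open>depth_le_minimal_cover\<close>). Indeed, if \<open>H\<^sub>i = 0\<close> for all \<open>i \<ge> |C|\<close>, then the same is true after
  replacing \<open>I\<close> by \<open>I : w\<close> for a variable \<open>w\<close>, and so for \<open>I : \<Prod>(V - C)\<close>. This ideal is generated by \<open>C\<close>,
  and the basis element of the Koszul complex that belongs to \<open>C\<close> is a cycle which does not bound.
  On the other hand, the ideal generated by a vertex cover \<open>C\<close> is a prime ideal containing \<open>I\<close>, so the
  height of the graded maximal ideal is at least \<open>|V - C|\<close> (\<open>cover_le_height\<close>).

  Now let \<open>A\<close>, \<open>B\<close> be the bipartition of \<open>G\<close> with \<open>u \<in> B\<close>. As there are no isolated vertices, \<open>A\<close> is a
  minimal vertex cover of \<open>G\<close>. Hence \<open>depth \<le> |B| \<le> height\<close>, and both are equalities because \<open>G\<close> is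
  Cohen--Macaulay. Since \<open>v\<close> has a neighbour other than \<open>u\<close>, and \<open>u\<close> is adjacent to \<open>v\<close> only, \<open>A\<close> is
  still a minimal vertex cover of \<open>G \<setminus> u\<close>. So the depth of \<open>G \<setminus> u\<close> is at most \<open>|B| - 1\<close>, and it is
  at least \<open>|B| - 1\<close> because one vertex has been deleted.
\<close>

section \<open>Subrings carried by a subset of a commutative ring\<close>

text \<open>
  Polynomial rings in different sets of variables are compared below, so they are treated as
  subrings of one ambient ring in the type class \<open>comm_ring_1\<close>: calculations take place in the
  type class, and only membership has to be tracked.
\<close>

definition ring_on :: "'a::comm_ring_1 set \<Rightarrow> 'a ring" where
  "ring_on S = \<lparr>carrier = S, monoid.mult = (*), one = 1, ring.zero = 0, add = (+)\<rparr>"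

lemma ring_on_simps [simp]:
  "carrier (ring_on S) = S" "monoid.mult (ring_on S) = (*)" "one (ring_on S) = 1"
  "ring.zero (ring_on S) = 0" "add (ring_on S) = (+)"
  by (simp_all add: ring_on_def)

locale subring_carrier =
  fixes S :: "'a::comm_ring_1 set"
  assumes one_mem: "1 \<in> S"
    and diff_mem: "\<And>a b. a \<in> S \<Longrightarrow> b \<in> S \<Longrightarrow> a - b \<in> S"
    and mult_mem: "\<And>a b. a \<in> S \<Longrightarrow> b \<in> S \<Longrightarrow> a * b \<in> S"
begin

abbreviation R :: "'a ring" where "R \<equiv> ring_on S"

lemma zero_mem: "0 \<in> S"
  using diff_mem[OF one_mem one_mem] by simp

lemma uminus_mem: "a \<in> S \<Longrightarrow> - a \<in> S"
  using diff_mem[OF zero_mem] by simp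

lemma add_mem: "a \<in> S \<Longrightarrow> b \<in> S \<Longrightarrow> a + b \<in> S"
  using diff_mem[of a "- b"] uminus_mem by simp

lemma sum_mem: "(\<And>i. i \<in> A \<Longrightarrow> f i \<in> S) \<Longrightarrow> sum f A \<in> S"
  by (induction A rule: infinite_finite_induct) (auto intro: zero_mem add_mem)

lemma prod_mem: "(\<And>i. i \<in> A \<Longrightarrow> f i \<in> S) \<Longrightarrow> prod f A \<in> S"
  by (induction A rule: infinite_finite_induct) (auto intro: one_mem mult_mem)

lemma cring_R: "cring R"
proof (rule cringI)
  show "abelian_group R"
  proof (rule abelian_groupI)
    fix a assume "a \<in> carrier R"
    then show "\<exists>b\<in>carrier R. b \<oplus>\<^bsub>R\<^esub> a = \<zero>\<^bsub>R\<^esub>"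
      by (intro bexI[of _ "- a"]) (auto intro: uminus_mem)
  qed (auto intro: add_mem zero_mem simp: algebra_simps)
  show "comm_monoid R"
    by (rule comm_monoidI) (auto intro: mult_mem one_mem simp: algebra_simps)
qed (auto simp: algebra_simps)

sublocale ring_R: cring R
  by (rule cring_R)

lemma ideal_iff:
  "ideal J R \<longleftrightarrow> J \<subseteq> S \<and> 0 \<in> J \<and> (\<forall>a\<in>J. \<forall>b\<in>J. a + b \<in> J) \<and> (\<forall>a\<in>J. \<forall>s\<in>S. s * a \<in> J)"
    (is "?L \<longleftrightarrow> ?R")
proof
  assume ?L
  then interpret ideal J R .
  show ?R
    using a_subset additive_subgroup.zero_closed[OF additive_subgroup_axioms]
      additive_subgroup.a_closed[OF additive_subgroup_axioms] I_l_closed by auto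
next
  assume r: ?R
  have inv: "inv\<^bsub>add_monoid R\<^esub> a \<in> J" if "a \<in> J" for a
  proof -
    have "a \<in> S" using that r by auto
    then have "inv\<^bsub>add_monoid R\<^esub> a = - a"
      using ring_R.minus_equality[of "- a" a] uminus_mem by (simp add: a_inv_def)
    moreover have "- a = (- 1) * a" by simp
    ultimately show ?thesis
      using r that uminus_mem[OF one_mem] by metis
  qed
  show ?L
  proof (rule idealI)
    show "ring R" by (rule ring_R.ring_axioms)
    show "subgroup J (add_monoid R)"
      using r inv by unfold_locales (auto simp: subgroup_def)
  qed (use r in \<open>auto simp: mult.commute\<close>)
qed

context
  fixes J assumes J: "ideal J R"
begin

lemma ideal_subset: "a \<in> J \<Longrightarrow> a \<in> S"
  using J by (auto simp: ideal_iff)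

lemma ideal_zero: "0 \<in> J"
  using J by (auto simp: ideal_iff)

lemma ideal_add: "a \<in> J \<Longrightarrow> b \<in> J \<Longrightarrow> a + b \<in> J"
  using J by (auto simp: ideal_iff)

lemma ideal_mult: "a \<in> J \<Longrightarrow> s \<in> S \<Longrightarrow> s * a \<in> J"
  using J by (auto simp: ideal_iff)

lemma ideal_mult_right: "a \<in> J \<Longrightarrow> s \<in> S \<Longrightarrow> a * s \<in> J"
  using ideal_mult[of a s] by (simp add: mult.commute)

lemma ideal_uminus: "a \<in> J \<Longrightarrow> - a \<in> J"
  using ideal_mult[of a "- 1"] uminus_mem[OF one_mem] by simp

lemma ideal_diff: "a \<in> J \<Longrightarrow> b \<in> J \<Longrightarrow> a - b \<in> J"
  using ideal_add[of a "- b"] ideal_uminus by simp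

lemma ideal_sum: "(\<And>i. i \<in> A \<Longrightarrow> f i \<in> J) \<Longrightarrow> sum f A \<in> J"
  by (induction A rule: infinite_finite_induct) (auto intro: ideal_zero ideal_add)

lemma ideal_diff_cancel: "a - b \<in> J \<Longrightarrow> b \<in> J \<Longrightarrow> a \<in> J"
  using ideal_add[of "a - b" b] by simp

end

text \<open>The ideal generated by \<open>J\<close> and \<open>f\<close>.\<close>

definition adjoin :: "'a set \<Rightarrow> 'a \<Rightarrow> 'a set" where
  "adjoin J f = {j + f * s | j s. j \<in> J \<and> s \<in> S}"

lemma adjoinE:
  assumes "p \<in> adjoin J f"
  obtains j s where "j \<in> J" "s \<in> S" "p = j + f * s"
  using assms by (auto simp: adjoin_def)

lemma adjoinI: "j \<in> J \<Longrightarrow> s \<in> S \<Longrightarrow> j + f * s \<in> adjoin J f"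
  by (auto simp: adjoin_def)

lemma adjoin_remainder: "p \<in> adjoin J f \<Longrightarrow> \<exists>s\<in>S. p - f * s \<in> J"
  by (elim adjoinE bexI[rotated]) simp

lemma adjoin_subset: "J \<subseteq> adjoin J f"
  using adjoinI[of _ J 0 f] zero_mem by auto

lemma ideal_adjoin:
  assumes J: "ideal J R" and f: "f \<in> S"
  shows "ideal (adjoin J f) R"
  unfolding ideal_iff
proof (intro conjI ballI)
  show "adjoin J f \<subseteq> S"
    using ideal_subset[OF J] by (fastforce simp: adjoin_def intro: add_mem mult_mem f)
  show "0 \<in> adjoin J f"
    using adjoin_subset ideal_zero[OF J] by auto
next
  fix a b assume "a \<in> adjoin J f" "b \<in> adjoin J f"
  then obtain j s j' s' where "j \<in> J" "s \<in> S" "j' \<in> J" "s' \<in> S"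
    "a = j + f * s" "b = j' + f * s'"
    by (auto elim!: adjoinE)
  then show "a + b \<in> adjoin J f"
    using adjoinI[of "j + j'" J "s + s'" f] ideal_add[OF J] add_mem by (simp add: algebra_simps)
next
  fix a t assume "a \<in> adjoin J f" "t \<in> S"
  moreover then obtain j s where "j \<in> J" "s \<in> S" "a = j + f * s"
    by (auto elim!: adjoinE)
  ultimately show "t * a \<in> adjoin J f"
    using adjoinI[of "t * j" J "t * s" f] ideal_mult[OF J] mult_mem by (simp add: algebra_simps)
qed

lemma adjoin_eq_genideal:
  assumes J: "ideal J R" and f: "f \<in> S"
  shows "adjoin J f = genideal R (insert f J)"
proof
  have sub: "insert f J \<subseteq> carrier R"
    using f ideal_subset[OF J] by auto
  note I = ring_R.genideal_ideal[OF sub]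
  have "insert f J \<subseteq> genideal R (insert f J)"
    by (rule ring_R.genideal_self[OF sub])
  then show "adjoin J f \<subseteq> genideal R (insert f J)"
    by (auto elim!: adjoinE intro!: ideal_add[OF I] ideal_mult_right[OF I])
  have "f \<in> adjoin J f"
    using adjoinI[OF ideal_zero[OF J] one_mem, of f] by simp
  then show "genideal R (insert f J) \<subseteq> adjoin J f"
    using adjoin_subset by (intro ring_R.genideal_minimal ideal_adjoin J f) auto
qed

text \<open>\<open>f\<close> is a non-zero-divisor on the module \<open>S / J\<close>.\<close>

definition regular_on :: "'a set \<Rightarrow> 'a \<Rightarrow> bool" where
  "regular_on J f \<longleftrightarrow> (\<forall>p\<in>S. f * p \<in> J \<longrightarrow> p \<in> J)"

end

section \<open>Non-zero-divisors in Noetherian rings\<close>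

context subring_carrier
begin

lemma primeideal_iff:
  "primeideal P R \<longleftrightarrow> ideal P R \<and> 1 \<notin> P \<and> (\<forall>a\<in>S. \<forall>b\<in>S. a * b \<in> P \<longrightarrow> a \<in> P \<or> b \<in> P)"
    (is "_ \<longleftrightarrow> ?R")
proof
  assume "primeideal P R"
  then interpret primeideal P R .
  have "1 \<notin> P"
    using one_imp_carrier I_notcarr by auto
  then show ?R
    using I_prime is_ideal by auto
next
  assume ?R
  then show "primeideal P R"
    using one_mem by (intro primeidealI cring_R) (auto simp: ideal_iff)
qed

lemma primeideal_prod:
  assumes P: "primeideal P R" and "finite A" and "\<And>i. i \<in> A \<Longrightarrow> f i \<in> S - P"
  shows "prod f A \<in> S - P"
  using assms(2,3)
proof (induction A rule: finite_induct)
  case empty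
  then show ?case using P one_mem by (auto simp: primeideal_iff)
next
  case (insert a A)
  then have "f a \<in> S - P" "prod f A \<in> S - P" by auto
  then show ?case using P insert.hyps by (auto simp: primeideal_iff intro: mult_mem)
qed

text \<open>
  The induction replaces an element \<open>f\<close> that avoids \<open>F\<close> but lies in the new prime \<open>P\<close> by \<open>f + g h\<close>
  with \<open>g\<close> in \<open>M\<close> but not in \<open>P\<close>, and \<open>h\<close> in all members of \<open>F\<close> but not in \<open>P\<close>.
\<close>

lemma prime_avoidance:
  assumes M: "ideal M R" and "finite F"
    and "\<And>P. P \<in> F \<Longrightarrow> primeideal P R"
    and "\<And>P Q. P \<in> F \<Longrightarrow> Q \<in> F \<Longrightarrow> P \<subseteq> Q \<Longrightarrow> P = Q"
    and "\<And>P. P \<in> F \<Longrightarrow> \<not> M \<subseteq> P"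
  shows "\<exists>f\<in>M. \<forall>P\<in>F. f \<notin> P"
  using assms(2-)
proof (induction F rule: finite_induct)
  case empty
  then show ?case using ideal_zero[OF M] by auto
next
  case (insert P F)
  have id: "\<And>Q. Q \<in> insert P F \<Longrightarrow> ideal Q R"
    using insert.prems(1) by (auto simp: primeideal_iff)
  have "\<exists>f\<in>M. \<forall>Q\<in>F. f \<notin> Q"
    using insert.prems by (intro insert.IH) auto
  then obtain f where f: "f \<in> M" "\<And>Q. Q \<in> F \<Longrightarrow> f \<notin> Q" by auto
  show ?case
  proof (cases "f \<in> P")
    case True
    obtain g where g: "g \<in> M" "g \<notin> P"
      using insert.prems(3)[of P] by auto
    have "\<forall>Q\<in>F. \<exists>h. h \<in> Q - P"
      using insert.prems(2)[of _ P] insert.hyps(2) by fastforce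
    then obtain h where h: "\<And>Q. Q \<in> F \<Longrightarrow> h Q \<in> Q - P" by metis
    have hS: "h Q \<in> S" if "Q \<in> F" for Q
      using ideal_subset[of Q] id h that by auto
    have prodP: "prod h F \<in> S - P"
      using insert.prems(1)[of P] insert.hyps h hS by (intro primeideal_prod) auto
    have prodQ: "prod h F \<in> Q" if Q: "Q \<in> F" for Q
    proof -
      have "prod h F = prod h (F - {Q}) * h Q"
        using Q insert.hyps by (simp add: prod.remove mult.commute)
      then show ?thesis
        using ideal_mult[of Q "h Q" "prod h (F - {Q})"] id h Q hS prod_mem[of "F - {Q}" h] by auto
    qed
    have "f + g * prod h F \<in> M"
      using prodP by (intro ideal_add[OF M] f ideal_mult_right[OF M] g) auto
    moreover have "f + g * prod h F \<notin> P"
    proof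
      assume "f + g * prod h F \<in> P"
      then have "g * prod h F \<in> P"
        using ideal_diff[OF id[of P], of "f + g * prod h F" f] True by simp
      then show False
        using insert.prems(1)[of P] g prodP ideal_subset[OF M] by (auto simp: primeideal_iff)
    qed
    moreover have "f + g * prod h F \<notin> Q" if Q: "Q \<in> F" for Q
    proof
      assume "f + g * prod h F \<in> Q"
      moreover have "g * prod h F \<in> Q"
        using ideal_mult[OF id[of Q] prodQ[OF Q]] ideal_subset[OF M] g Q by auto
      ultimately have "f \<in> Q"
        using ideal_diff[OF id[of Q], of "f + g * prod h F" "g * prod h F"] Q by simp
      then show False using f Q by auto
    qed
    ultimately show ?thesis by auto
  qed (use f in auto)
qed

text \<open>
  The Noetherian property of \<open>S / I\<close>, expressed by ideals of \<open>S\<close>.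
\<close>

definition ideal_maximum_condition :: "'a set \<Rightarrow> bool" where
  "ideal_maximum_condition I \<longleftrightarrow>
     (\<forall>\<K>. \<K> \<noteq> {} \<and> (\<forall>K\<in>\<K>. ideal K R \<and> I \<subseteq> K) \<longrightarrow> (\<exists>M\<in>\<K>. \<forall>K\<in>\<K>. M \<subseteq> K \<longrightarrow> K = M))"

definition colon :: "'a set \<Rightarrow> 'a \<Rightarrow> 'a set" where
  "colon J p = {r \<in> S. r * p \<in> J}"

lemma ideal_colon:
  assumes J: "ideal J R" and p: "p \<in> S"
  shows "ideal (colon J p) R"
  unfolding ideal_iff colon_def
  using ideal_zero[OF J] ideal_add[OF J] ideal_mult[OF J] p
  by (auto simp: zero_mem add_mem mult_mem distrib_right mult.assoc)

lemma subset_colon: "ideal J R \<Longrightarrow> p \<in> S \<Longrightarrow> J \<subseteq> colon J p"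
  by (auto simp: colon_def intro: ideal_mult_right ideal_subset)

text \<open>
  The maximal annihilators of non-zero elements of \<open>S / J\<close> are prime. There are only finitely many
  of them: the elements of \<open>S / J\<close> annihilated by the intersection of a finite set \<open>F\<close> of them form a
  submodule that grows with \<open>F\<close>, and if it is as large as possible, then every maximal annihilator
  contains the intersection of \<open>F\<close>, hence contains a member of \<open>F\<close>, hence is one.
\<close>

lemma finite_maximal_colons:
  fixes J
  assumes J: "ideal J R" and IJ: "I \<subseteq> J" and max: "ideal_maximum_condition I"
  defines "A \<equiv> {colon J p | p. p \<in> S - J}"
  defines "Z \<equiv> {P \<in> A. \<forall>Q\<in>A. P \<subseteq> Q \<longrightarrow> Q = P}"
  shows "finite Z" and "\<And>P. P \<in> Z \<Longrightarrow> primeideal P R"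
    and "\<And>Q. Q \<in> A \<Longrightarrow> \<exists>P\<in>Z. Q \<subseteq> P"
proof -
  have AI: "ideal Q R \<and> J \<subseteq> Q" if "Q \<in> A" for Q
    using that ideal_colon[OF J] subset_colon[OF J] by (auto simp: A_def)
  show pr: "primeideal P R" if P: "P \<in> Z" for P
  proof -
    obtain p where p: "p \<in> S - J" "P = colon J p"
      using P by (auto simp: Z_def A_def)
    have "b \<in> P" if ab: "a \<in> S" "b \<in> S" "a * b \<in> P" "a \<notin> P" for a b
    proof -
      have ap: "a * p \<in> S - J"
        using ab p by (auto simp: colon_def intro: mult_mem)
      have "P \<subseteq> colon J (a * p)"
      proof (rule subsetI)
        fix r assume "r \<in> P"
        then have "r \<in> S" "a * (r * p) \<in> J"
          using p ideal_mult[OF J _ ab(1)] by (auto simp: colon_def)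
        then show "r \<in> colon J (a * p)"
          by (simp add: colon_def mult.left_commute)
      qed
      then have "colon J (a * p) = P"
        using P ap by (auto simp: Z_def A_def)
      moreover have "b \<in> colon J (a * p)"
        using ab p by (auto simp: colon_def mult_ac)
      ultimately show ?thesis by simp
    qed
    moreover have "1 \<notin> P"
      using p by (auto simp: colon_def)
    moreover have "ideal P R"
      using AI P by (auto simp: Z_def)
    ultimately show ?thesis by (auto simp: primeideal_iff)
  qed
  show "\<exists>P\<in>Z. Q \<subseteq> P" if Q: "Q \<in> A" for Q
  proof -
    have "{Q' \<in> A. Q \<subseteq> Q'} \<noteq> {} \<and> (\<forall>K\<in>{Q' \<in> A. Q \<subseteq> Q'}. ideal K R \<and> I \<subseteq> K)"
      using Q AI IJ by auto
    from max[unfolded ideal_maximum_condition_def, rule_format, OF this]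
    obtain M where "M \<in> A" "Q \<subseteq> M" "\<forall>K\<in>{Q' \<in> A. Q \<subseteq> Q'}. M \<subseteq> K \<longrightarrow> K = M" by auto
    then show ?thesis by (intro bexI[of _ M]) (auto simp: Z_def)
  qed
  define K where "K F = {q \<in> S. \<forall>r\<in>S. (\<forall>P\<in>F. r \<in> P) \<longrightarrow> r * q \<in> J}" for F :: "'a set set"
  have K: "ideal (K F) R \<and> J \<subseteq> K F" for F
  proof
    show "ideal (K F) R"
      unfolding ideal_iff
    proof (intro conjI ballI)
      fix a s assume "a \<in> K F" and s: "s \<in> S"
      then have "a \<in> S" and *: "\<And>r. r \<in> S \<Longrightarrow> (\<forall>P\<in>F. r \<in> P) \<Longrightarrow> r * (s * a) \<in> J"
        using ideal_mult[OF J _ s] by (auto simp: K_def mult.left_commute[of _ s])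
      then show "s * a \<in> K F"
        using s mult_mem by (auto simp: K_def)
    qed (use ideal_zero[OF J] ideal_add[OF J] in
        \<open>auto simp: K_def zero_mem add_mem distrib_left\<close>)
    show "J \<subseteq> K F"
      using ideal_mult[OF J] ideal_subset[OF J] by (auto simp: K_def)
  qed
  have mono: "F \<subseteq> F' \<Longrightarrow> K F \<subseteq> K F'" for F F'
    by (auto simp: K_def)
  define \<K> where "\<K> = K ` {F. finite F \<and> F \<subseteq> Z}"
  have "\<K> \<noteq> {} \<and> (\<forall>L\<in>\<K>. ideal L R \<and> I \<subseteq> L)"
    using K IJ unfolding \<K>_def by (auto intro: exI[of _ "{}"])
  from max[unfolded ideal_maximum_condition_def, rule_format, OF this]
  obtain L where L: "L \<in> \<K>" "\<forall>L'\<in>\<K>. L \<subseteq> L' \<longrightarrow> L' = L" by (elim bexE) simp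
  from L(1) obtain F where F: "finite F" "F \<subseteq> Z" and LF: "L = K F" by (auto simp: \<K>_def)
  have Fmax: "K F' = K F" if "finite F'" "F' \<subseteq> Z" "K F \<subseteq> K F'" for F'
    using L(2) that by (simp add: LF \<K>_def)
  have "Q \<in> F" if Q: "Q \<in> Z" for Q
  proof -
    obtain q where q: "q \<in> S - J" "Q = colon J q"
      using Q by (auto simp: Z_def A_def)
    have "K (insert Q F) = K F"
      using F Q by (intro Fmax mono) auto
    moreover have "q \<in> K (insert Q F)"
      using q by (auto simp: K_def colon_def)
    ultimately have qK: "r \<in> Q" if "r \<in> S" "\<forall>P\<in>F. r \<in> P" for r
      using that q by (auto simp: K_def colon_def)
    have "\<exists>P\<in>F. P \<subseteq> Q"
    proof (rule ccontr)
      assume "\<not> ?thesis"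
      then have "\<forall>P\<in>F. \<exists>y. y \<in> P - Q" by auto
      then obtain y where y: "\<And>P. P \<in> F \<Longrightarrow> y P \<in> P - Q" by metis
      have FI: "ideal P R" if "P \<in> F" for P
        using that F AI by (auto simp: Z_def)
      have yS: "y P \<in> S" if "P \<in> F" for P
        using y ideal_subset[OF FI] that by auto
      have "prod y F \<in> S - Q"
        using y yS by (intro primeideal_prod pr Q F(1)) auto
      moreover have "prod y F \<in> P" if P: "P \<in> F" for P
      proof -
        have "prod y F = prod y (F - {P}) * y P"
          using P F(1) by (simp add: prod.remove mult.commute)
        then show ?thesis
          using ideal_mult[OF FI[OF P], of "y P" "prod y (F - {P})"] y P yS
            prod_mem[of "F - {P}" y] by auto
      qed
      ultimately show False using qK by auto
    qed
    then show "Q \<in> F" using F Q by (auto simp: Z_def)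
  qed
  then show "finite Z" using F(1) finite_subset[of Z F] by auto
qed

text \<open>
  The zero-divisors on \<open>S / J\<close> are the union of the maximal annihilators. If \<open>M\<close> consisted of
  zero-divisors, then by prime avoidance it would annihilate a single non-zero element.
\<close>

lemma exists_regular_element:
  assumes J: "ideal J R" and IJ: "I \<subseteq> J" and max: "ideal_maximum_condition I"
    and M: "ideal M R"
    and socle: "\<And>p. p \<in> S \<Longrightarrow> (\<And>f. f \<in> M \<Longrightarrow> f * p \<in> J) \<Longrightarrow> p \<in> J"
  shows "\<exists>f\<in>M. regular_on J f"
proof -
  define A where "A = {colon J p | p. p \<in> S - J}"
  define Z where "Z = {P \<in> A. \<forall>Q\<in>A. P \<subseteq> Q \<longrightarrow> Q = P}"
  note Z = finite_maximal_colons[OF J IJ max, folded A_def, folded Z_def]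
  have "\<exists>f\<in>M. \<forall>P\<in>Z. f \<notin> P"
  proof (rule prime_avoidance[OF M Z(1,2)])
    fix P assume "P \<in> Z"
    then obtain p where p: "p \<in> S - J" "P = colon J p"
      by (auto simp: Z_def A_def)
    show "\<not> M \<subseteq> P"
    proof
      assume "M \<subseteq> P"
      then have "p \<in> J" using p by (metis (no_types, lifting) DiffE colon_def mem_Collect_eq socle subsetD)
      then show False using p by auto
    qed
  qed (auto simp: Z_def)
  then obtain f where f: "f \<in> M" "\<And>P. P \<in> Z \<Longrightarrow> f \<notin> P" by auto
  have "regular_on J f"
    unfolding regular_on_def
  proof (intro ballI impI, rule ccontr)
    fix p assume p: "p \<in> S" "f * p \<in> J" "p \<notin> J"
    then have "colon J p \<in> A" by (auto simp: A_def)
    from Z(3)[OF this] obtain P where P: "P \<in> Z" "colon J p \<subseteq> P" by auto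
    have "f \<in> colon J p"
      using p f ideal_subset[OF M] by (auto simp: colon_def)
    then show False using P f by auto
  qed
  then show ?thesis using f by auto
qed

text \<open>
  Regular sequences on \<open>S / J\<close>, without the requirement that they generate a proper ideal.
\<close>

primrec regular_seq_on :: "'a set \<Rightarrow> 'a list \<Rightarrow> bool" where
  "regular_seq_on J [] \<longleftrightarrow> True"
| "regular_seq_on J (f # fs) \<longleftrightarrow> regular_on J f \<and> regular_seq_on (adjoin J f) fs"

end

section \<open>The Koszul complex of a cyclic module\<close>

text \<open>
  Subsets of \<open>V\<close> index the basis of the exterior algebra. A chain is the family of its coefficients;
  \<open>rank\<close> orders the basis vectors, which fixes the signs. A degree \<open>i\<close> chain is given by the values
  at the subsets of cardinality \<open>i\<close>, and all other values of the function are immaterial.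
\<close>

definition koszul_sign :: "('v \<Rightarrow> nat) \<Rightarrow> 'v \<Rightarrow> 'v set \<Rightarrow> 'a::comm_ring_1" where
  "koszul_sign rank v \<tau> = (- 1) ^ card {w \<in> \<tau>. rank w < rank v}"

definition koszul_boundary ::
    "('v \<Rightarrow> nat) \<Rightarrow> ('v \<Rightarrow> 'a) \<Rightarrow> 'v set \<Rightarrow> ('v set \<Rightarrow> 'a) \<Rightarrow> 'v set \<Rightarrow> 'a::comm_ring_1" where
  "koszul_boundary rank x V c \<tau> =
     (\<Sum>v\<in>V - \<tau>. koszul_sign rank v \<tau> * x v * c (insert v \<tau>))"

text \<open>
  Vanishing of the \<open>i\<close>-th Koszul homology of \<open>S / J\<close>: every \<open>i\<close>-chain over \<open>S\<close> whose boundary is zero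
  modulo \<open>J\<close> is a boundary modulo \<open>J\<close>. For \<open>i = 0\<close> every chain is a cycle.
\<close>

definition koszul_acyclic ::
    "('v \<Rightarrow> nat) \<Rightarrow> ('v \<Rightarrow> 'a::comm_ring_1) \<Rightarrow> 'a set \<Rightarrow> 'v set \<Rightarrow> 'a set \<Rightarrow> nat \<Rightarrow> bool" where
  "koszul_acyclic rank x S V J i \<longleftrightarrow>
     (\<forall>c. (\<forall>\<sigma>. c \<sigma> \<in> S) \<and>
          (\<forall>\<tau>\<subseteq>V. Suc (card \<tau>) = i \<longrightarrow> koszul_boundary rank x V c \<tau> \<in> J) \<longrightarrow>
          (\<exists>b. (\<forall>\<sigma>. b \<sigma> \<in> S) \<and>
               (\<forall>\<sigma>\<subseteq>V. card \<sigma> = i \<longrightarrow> c \<sigma> - koszul_boundary rank x V b \<sigma> \<in> J)))"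

lemma koszul_sign_square [simp]:
  "koszul_sign rank v \<tau> * koszul_sign rank v \<tau> = (1::'a::comm_ring_1)"
  by (cases "even (card {w \<in> \<tau>. rank w < rank v})") (simp_all add: koszul_sign_def)

lemma koszul_sign_square' [simp]:
  "koszul_sign rank v \<tau> * (koszul_sign rank v \<tau> * a) = (a::'a::comm_ring_1)"
  by (simp flip: mult.assoc)

lemma koszul_sign_insert:
  assumes "finite \<tau>" "w \<notin> \<tau>"
  shows "koszul_sign rank v (insert w \<tau>) =
    (if rank w < rank v then - koszul_sign rank v \<tau> else (koszul_sign rank v \<tau> :: 'a::comm_ring_1))"
proof (cases "rank w < rank v")
  case True
  then have "{z \<in> insert w \<tau>. rank z < rank v} = insert w {z \<in> \<tau>. rank z < rank v}" by auto
  then show ?thesis using True assms by (simp add: koszul_sign_def)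
next
  case False
  then have "{z \<in> insert w \<tau>. rank z < rank v} = {z \<in> \<tau>. rank z < rank v}" by auto
  then show ?thesis using False by (simp add: koszul_sign_def)
qed

lemma koszul_sign_swap:
  assumes "finite \<tau>" "v \<notin> \<tau>" "w \<notin> \<tau>" "rank v \<noteq> rank w"
  shows "koszul_sign rank v (insert w \<tau>) * koszul_sign rank w \<tau> =
    - (koszul_sign rank w (insert v \<tau>) * koszul_sign rank v \<tau> :: 'a::comm_ring_1)"
  using assms by (auto simp: koszul_sign_insert mult.commute)

lemma koszul_sign_swap':
  assumes "finite \<tau>" "v \<notin> \<tau>" "w \<notin> \<tau>" "rank v \<noteq> rank w"
  shows "koszul_sign rank v (insert w \<tau>) * koszul_sign rank w (insert v \<tau>) =
    - (koszul_sign rank w \<tau> * koszul_sign rank v \<tau> :: 'a::comm_ring_1)"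
  using assms by (auto simp: koszul_sign_insert mult.commute)

text \<open>
  Pairing off the terms would give twice the sum only, which is not enough in characteristic 2;
  hence the induction.
\<close>

lemma sum_antisymmetric_pairs:
  fixes F :: "'v \<Rightarrow> 'v \<Rightarrow> 'a::ab_group_add"
  assumes "finite A" and "\<And>v w. v \<in> A \<Longrightarrow> w \<in> A \<Longrightarrow> v \<noteq> w \<Longrightarrow> F w v = - F v w"
  shows "(\<Sum>v\<in>A. \<Sum>w\<in>A - {v}. F v w) = 0"
  using assms
proof (induction A rule: finite_induct)
  case (insert a A)
  note IH = insert.IH[OF insert.prems, OF insertI2 insertI2]
  have "(\<Sum>v\<in>A. \<Sum>w\<in>insert a A - {v}. F v w) = (\<Sum>v\<in>A. F v a + (\<Sum>w\<in>A - {v}. F v w))"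
  proof (rule sum.cong)
    fix v assume "v \<in> A"
    then have "insert a A - {v} = insert a (A - {v})" using insert.hyps by auto
    then show "(\<Sum>w\<in>insert a A - {v}. F v w) = F v a + (\<Sum>w\<in>A - {v}. F v w)"
      using insert.hyps by simp
  qed simp
  also have "\<dots> = (\<Sum>v\<in>A. F v a)"
    using IH by (simp add: sum.distrib)
  also have "\<dots> = (\<Sum>v\<in>A. - F a v)"
    using insert.hyps by (intro sum.cong insert.prems refl) auto
  finally show ?case
    using insert.hyps by (simp add: sum_negf)
qed simp

locale koszul_complex = subring_carrier S for S :: "'a::comm_ring_1 set" +
  fixes V :: "'v set" and x :: "'v \<Rightarrow> 'a" and rank :: "'v \<Rightarrow> nat"
  assumes finite_V: "finite V"
    and x_mem: "v \<in> V \<Longrightarrow> x v \<in> S"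
    and inj_rank: "inj_on rank V"
begin

abbreviation sg :: "'v \<Rightarrow> 'v set \<Rightarrow> 'a" where "sg \<equiv> koszul_sign rank"
abbreviation bd :: "('v set \<Rightarrow> 'a) \<Rightarrow> 'v set \<Rightarrow> 'a" where "bd \<equiv> koszul_boundary rank x V"
abbreviation acyclic :: "'a set \<Rightarrow> nat \<Rightarrow> bool" where "acyclic \<equiv> koszul_acyclic rank x S V"

lemma sg_mem: "sg v \<tau> \<in> S"
  by (cases "even (card {w \<in> \<tau>. rank w < rank v})")
    (auto simp: koszul_sign_def intro: one_mem uminus_mem)

lemma bd_mem: "(\<And>\<sigma>. c \<sigma> \<in> S) \<Longrightarrow> bd c \<tau> \<in> S"
  unfolding koszul_boundary_def by (intro sum_mem mult_mem sg_mem x_mem) auto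

lemma rank_neq: "v \<in> V \<Longrightarrow> w \<in> V \<Longrightarrow> v \<noteq> w \<Longrightarrow> rank v \<noteq> rank w"
  using inj_rank by (auto dest: inj_onD)

lemma bd_bd:
  assumes \<tau>: "\<tau> \<subseteq> V"
  shows "bd (bd c) \<tau> = 0"
proof -
  define F where "F v w = sg v \<tau> * x v * (sg w (insert v \<tau>) * x w * c (insert w (insert v \<tau>)))" for v w
  have fin: "finite \<tau>" using \<tau> finite_V finite_subset by blast
  have "bd (bd c) \<tau> = (\<Sum>v\<in>V - \<tau>. \<Sum>w\<in>(V - \<tau>) - {v}. F v w)"
    unfolding koszul_boundary_def F_def sum_distrib_left
    by (intro sum.cong) auto
  also have "\<dots> = 0"
  proof (rule sum_antisymmetric_pairs)
    fix v w assume vw: "v \<in> V - \<tau>" "w \<in> V - \<tau>" "v \<noteq> w"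
    have "sg v (insert w \<tau>) * sg w \<tau> = - (sg w (insert v \<tau>) * sg v \<tau>)"
      using vw fin rank_neq by (intro koszul_sign_swap) auto
    moreover have "F w v = (sg v (insert w \<tau>) * sg w \<tau>) * (x v * x w * c (insert w (insert v \<tau>)))"
      by (simp add: F_def insert_commute mult_ac)
    moreover have "F v w = (sg w (insert v \<tau>) * sg v \<tau>) * (x v * x w * c (insert w (insert v \<tau>)))"
      by (simp add: F_def mult_ac)
    ultimately show "F w v = - F v w" by simp
  qed (use finite_V in auto)
  finally show ?thesis .
qed

lemma bd_diff: "bd (\<lambda>\<sigma>. c \<sigma> - d \<sigma>) \<tau> = bd c \<tau> - bd d \<tau>"
  by (simp add: koszul_boundary_def algebra_simps sum_subtractf)

lemma bd_scale: "bd (\<lambda>\<sigma>. f * c \<sigma>) \<tau> = f * bd c \<tau>"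
  by (simp add: koszul_boundary_def sum_distrib_left mult_ac)

lemma bd_in_ideal:
  assumes J: "ideal J R" and "\<And>v. v \<in> V - \<tau> \<Longrightarrow> c (insert v \<tau>) \<in> J"
  shows "bd c \<tau> \<in> J"
  unfolding koszul_boundary_def
  using assms(2) by (intro ideal_sum[OF J] ideal_mult[OF J] mult_mem sg_mem x_mem) auto

text \<open>
  Exterior multiplication by the element \<open>\<Sum>v. g v e\<^sub>v\<close> of degree 1.
\<close>

definition contraction :: "('v \<Rightarrow> 'a) \<Rightarrow> ('v set \<Rightarrow> 'a) \<Rightarrow> 'v set \<Rightarrow> 'a" where
  "contraction g c \<sigma> = (\<Sum>w\<in>\<sigma>. sg w (\<sigma> - {w}) * g w * c (\<sigma> - {w}))"

text \<open>
  An element \<open>f\<close> of the ideal generated by the variables acts on the Koszul complex as a map that is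
  homotopic to zero. This is why \<open>f\<close> annihilates the homology.
\<close>

lemma homotopy:
  assumes \<sigma>: "\<sigma> \<subseteq> V"
  shows "bd (contraction g c) \<sigma> + contraction g (bd c) \<sigma> = (\<Sum>v\<in>V. g v * x v) * c \<sigma>"
proof -
  have fin: "finite \<sigma>" using \<sigma> finite_V finite_subset by blast
  define P where "P v w = sg v \<sigma> * x v * (sg w (insert v \<sigma> - {w}) * g w * c (insert v \<sigma> - {w}))" for v w
  define Q where "Q w v = sg w (\<sigma> - {w}) * g w * (sg v (\<sigma> - {w}) * x v * c (insert v (\<sigma> - {w})))" for v w
  have 1: "bd (contraction g c) \<sigma> = (\<Sum>v\<in>V - \<sigma>. g v * x v * c \<sigma> + (\<Sum>w\<in>\<sigma>. P v w))"
    unfolding koszul_boundary_def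
  proof (intro sum.cong refl)
    fix v assume v: "v \<in> V - \<sigma>"
    then have "insert v \<sigma> - {v} = \<sigma>" by auto
    then show "sg v \<sigma> * x v * contraction g c (insert v \<sigma>) = g v * x v * c \<sigma> + (\<Sum>w\<in>\<sigma>. P v w)"
      using v fin by (simp add: contraction_def P_def sum_distrib_left distrib_left mult_ac)
  qed
  have 2: "contraction g (bd c) \<sigma> = (\<Sum>w\<in>\<sigma>. g w * x w * c \<sigma> + (\<Sum>v\<in>V - \<sigma>. Q w v))"
    unfolding contraction_def
  proof (intro sum.cong refl)
    fix w assume w: "w \<in> \<sigma>"
    then have "V - (\<sigma> - {w}) = insert w (V - \<sigma>)" using \<sigma> by auto
    moreover have "insert w (\<sigma> - {w}) = \<sigma>" using w by auto
    ultimately show "sg w (\<sigma> - {w}) * g w * bd c (\<sigma> - {w}) = g w * x w * c \<sigma> + (\<Sum>v\<in>V - \<sigma>. Q w v)"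
      using w finite_V by (simp add: koszul_boundary_def Q_def sum_distrib_left distrib_left mult_ac)
  qed
  have PQ: "P v w + Q w v = 0" if "v \<in> V - \<sigma>" "w \<in> \<sigma>" for v w
  proof -
    have eq: "insert v \<sigma> - {w} = insert v (\<sigma> - {w})" "insert w (\<sigma> - {w}) = \<sigma>" using that by auto
    have "sg v (insert w (\<sigma> - {w})) * sg w (insert v (\<sigma> - {w})) =
        - (sg w (\<sigma> - {w}) * sg v (\<sigma> - {w}))"
      using that \<sigma> fin rank_neq[of v w] by (intro koszul_sign_swap') auto
    then have s: "sg v \<sigma> * sg w (insert v (\<sigma> - {w})) = - (sg w (\<sigma> - {w}) * sg v (\<sigma> - {w}))"
      unfolding eq .
    have "P v w = (sg v \<sigma> * sg w (insert v (\<sigma> - {w}))) * (x v * g w * c (insert v (\<sigma> - {w})))"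
      by (simp add: P_def eq mult_ac)
    then show ?thesis
      unfolding s by (simp add: Q_def mult_ac)
  qed
  have "(\<Sum>v\<in>V - \<sigma>. \<Sum>w\<in>\<sigma>. P v w) + (\<Sum>w\<in>\<sigma>. \<Sum>v\<in>V - \<sigma>. Q w v) =
      (\<Sum>v\<in>V - \<sigma>. \<Sum>w\<in>\<sigma>. P v w + Q w v)"
    using sum.swap[of "\<lambda>w v. Q w v" "V - \<sigma>" \<sigma>] by (simp add: sum.distrib)
  also have "\<dots> = 0" using PQ by simp
  finally have "bd (contraction g c) \<sigma> + contraction g (bd c) \<sigma> =
      (\<Sum>v\<in>V - \<sigma>. g v * x v * c \<sigma>) + (\<Sum>w\<in>\<sigma>. g w * x w * c \<sigma>)"
    unfolding 1 2 by (simp add: sum.distrib algebra_simps)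
  also have "\<dots> = (\<Sum>v\<in>V. g v * x v * c \<sigma>)"
    using sum.subset_diff[OF \<sigma> finite_V, of "\<lambda>v. g v * x v * c \<sigma>"] by simp
  finally show ?thesis by (simp add: sum_distrib_right)
qed

definition var_ideal :: "'a set" where
  "var_ideal = {\<Sum>v\<in>V. g v * x v | g. \<forall>v. g v \<in> S}"

lemma contraction_mem: "(\<And>v. g v \<in> S) \<Longrightarrow> (\<And>\<sigma>. c \<sigma> \<in> S) \<Longrightarrow> contraction g c \<sigma> \<in> S"
  unfolding contraction_def by (intro sum_mem mult_mem sg_mem)

lemma contraction_in_ideal:
  assumes J: "ideal J R" and "\<And>v. g v \<in> S" and "\<And>w. w \<in> \<sigma> \<Longrightarrow> c (\<sigma> - {w}) \<in> J"
  shows "contraction g c \<sigma> \<in> J"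
  unfolding contraction_def
  using assms(2,3) by (intro ideal_sum[OF J] ideal_mult[OF J] mult_mem sg_mem) auto

lemma acyclicI:
  assumes "\<And>c. (\<And>\<sigma>. c \<sigma> \<in> S) \<Longrightarrow> (\<And>\<tau>. \<tau> \<subseteq> V \<Longrightarrow> Suc (card \<tau>) = i \<Longrightarrow> bd c \<tau> \<in> J) \<Longrightarrow>
    \<exists>b. (\<forall>\<sigma>. b \<sigma> \<in> S) \<and> (\<forall>\<sigma>\<subseteq>V. card \<sigma> = i \<longrightarrow> c \<sigma> - bd b \<sigma> \<in> J)"
  shows "acyclic J i"
  using assms unfolding koszul_acyclic_def by blast

lemma acyclicE:
  assumes "acyclic J i" and "\<And>\<sigma>. c \<sigma> \<in> S"
    and "\<And>\<tau>. \<tau> \<subseteq> V \<Longrightarrow> Suc (card \<tau>) = i \<Longrightarrow> bd c \<tau> \<in> J"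
  obtains b where "\<And>\<sigma>. b \<sigma> \<in> S" "\<And>\<sigma>. \<sigma> \<subseteq> V \<Longrightarrow> card \<sigma> = i \<Longrightarrow> c \<sigma> - bd b \<sigma> \<in> J"
  using assms unfolding koszul_acyclic_def by blast

lemma card_insert_V: "\<tau> \<subseteq> V \<Longrightarrow> v \<in> V - \<tau> \<Longrightarrow> card (insert v \<tau>) = Suc (card \<tau>)"
  using finite_subset[OF _ finite_V] by (simp add: card_insert_disjoint)

text \<open>
  In the long exact sequence of multiplication by \<open>f\<close> on \<open>S / J\<close>, the connecting map sends
  \<open>H\<^sub>i\<^sub>+\<^sub>1(S / (J, f))\<close> onto the kernel of \<open>f\<close> on \<open>H\<^sub>i(S / J)\<close>, which is everything by the homotopy. A cycle
  \<open>c\<close> modulo \<open>J\<close> is the image of the cycle \<open>contraction g c\<close> modulo \<open>(J, f)\<close>.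
\<close>

lemma acyclic_of_adjoin:
  assumes J: "ideal J R" and f: "f \<in> var_ideal" and reg: "regular_on J f"
    and ac: "acyclic (adjoin J f) (Suc i)"
  shows "acyclic J i"
proof (rule acyclicI)
  fix c assume c: "\<And>\<sigma>. c \<sigma> \<in> S"
    and cyc: "\<And>\<tau>. \<tau> \<subseteq> V \<Longrightarrow> Suc (card \<tau>) = i \<Longrightarrow> bd c \<tau> \<in> J"
  obtain g where g: "\<And>v. g v \<in> S" and fg: "f = (\<Sum>v\<in>V. g v * x v)"
    using f by (auto simp: var_ideal_def)
  have fS: "f \<in> S" unfolding fg using g by (intro sum_mem mult_mem x_mem) auto
  have h: "f * c \<sigma> - bd (contraction g c) \<sigma> \<in> J" if "\<sigma> \<subseteq> V" "card \<sigma> = i" for \<sigma>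
  proof -
    have "contraction g (bd c) \<sigma> \<in> J"
    proof (rule contraction_in_ideal[OF J g], rule cyc)
      fix w assume "w \<in> \<sigma>"
      then show "Suc (card (\<sigma> - {w})) = i"
        using that finite_subset[OF that(1) finite_V]
        by (metis card_Suc_Diff1)
    qed (use that in auto)
    then show ?thesis
      using homotopy[OF that(1), of g c] unfolding fg by (metis add_diff_cancel_left')
  qed
  obtain b where b: "\<And>\<sigma>. b \<sigma> \<in> S"
    and cb: "\<And>\<sigma>. \<sigma> \<subseteq> V \<Longrightarrow> card \<sigma> = Suc i \<Longrightarrow> contraction g c \<sigma> - bd b \<sigma> \<in> adjoin J f"
  proof (rule acyclicE[OF ac, of "contraction g c"])
    show "contraction g c \<sigma> \<in> S" for \<sigma>
      by (intro contraction_mem g c)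
    fix \<tau> assume \<tau>: "\<tau> \<subseteq> V" "Suc (card \<tau>) = Suc i"
    have "bd (contraction g c) \<tau> = - (f * c \<tau> - bd (contraction g c) \<tau>) + f * c \<tau>"
      by simp
    then show "bd (contraction g c) \<tau> \<in> adjoin J f"
      using adjoinI[OF ideal_uminus[OF J h[of \<tau>]] c[of \<tau>], of f] \<tau> by simp
  qed blast
  have "\<forall>\<sigma>. \<exists>e\<in>S. \<sigma> \<subseteq> V \<and> card \<sigma> = Suc i \<longrightarrow> contraction g c \<sigma> - bd b \<sigma> - f * e \<in> J"
  proof
    fix \<sigma>
    show "\<exists>e\<in>S. \<sigma> \<subseteq> V \<and> card \<sigma> = Suc i \<longrightarrow> contraction g c \<sigma> - bd b \<sigma> - f * e \<in> J"
    proof (cases "\<sigma> \<subseteq> V \<and> card \<sigma> = Suc i")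
      case True
      then show ?thesis using adjoin_remainder[OF cb[of \<sigma>]] by auto
    qed (use zero_mem in auto)
  qed
  then obtain e where e: "\<And>\<sigma>. e \<sigma> \<in> S"
    and ce: "\<And>\<sigma>. \<sigma> \<subseteq> V \<Longrightarrow> card \<sigma> = Suc i \<Longrightarrow> contraction g c \<sigma> - bd b \<sigma> - f * e \<sigma> \<in> J"
    by metis
  show "\<exists>b. (\<forall>\<sigma>. b \<sigma> \<in> S) \<and> (\<forall>\<sigma>\<subseteq>V. card \<sigma> = i \<longrightarrow> c \<sigma> - bd b \<sigma> \<in> J)"
  proof (intro exI[of _ e] conjI allI impI e)
    fix \<sigma> assume \<sigma>: "\<sigma> \<subseteq> V" "card \<sigma> = i"
    have "bd (\<lambda>\<sigma>. contraction g c \<sigma> - bd b \<sigma> - f * e \<sigma>) \<sigma> \<in> J"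
      using \<sigma> card_insert_V by (intro bd_in_ideal[OF J] ce) auto
    then have "bd (contraction g c) \<sigma> - f * bd e \<sigma> \<in> J"
      by (simp add: bd_diff bd_scale bd_bd[OF \<sigma>(1)])
    from ideal_add[OF J this h[OF \<sigma>]] have "f * (c \<sigma> - bd e \<sigma>) \<in> J"
      by (simp add: algebra_simps)
    then show "c \<sigma> - bd e \<sigma> \<in> J"
      using reg c bd_mem[of e, OF e] diff_mem by (auto simp: regular_on_def)
  qed
qed

text \<open>
  In the same long exact sequence, \<open>H\<^sub>i\<^sub>+\<^sub>1(S / (J, f))\<close> sits between \<open>H\<^sub>i\<^sub>+\<^sub>1(S / J)\<close> and \<open>H\<^sub>i(S / J)\<close>.
\<close>

lemma adjoin_acyclic:
  assumes J: "ideal J R" and f: "f \<in> S" and reg: "regular_on J f"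
    and ac: "acyclic J i" "acyclic J (Suc i)"
  shows "acyclic (adjoin J f) (Suc i)"
proof (rule acyclicI)
  fix c assume c: "\<And>\<sigma>. c \<sigma> \<in> S"
    and cyc: "\<And>\<tau>. \<tau> \<subseteq> V \<Longrightarrow> Suc (card \<tau>) = Suc i \<Longrightarrow> bd c \<tau> \<in> adjoin J f"
  have "\<forall>\<tau>. \<exists>e\<in>S. \<tau> \<subseteq> V \<and> card \<tau> = i \<longrightarrow> bd c \<tau> - f * e \<in> J"
  proof
    fix \<tau>
    show "\<exists>e\<in>S. \<tau> \<subseteq> V \<and> card \<tau> = i \<longrightarrow> bd c \<tau> - f * e \<in> J"
    proof (cases "\<tau> \<subseteq> V \<and> card \<tau> = i")
      case True
      then show ?thesis using adjoin_remainder[OF cyc[of \<tau>]] by auto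
    qed (use zero_mem in auto)
  qed
  then obtain d where d: "\<And>\<sigma>. d \<sigma> \<in> S"
    and cd: "\<And>\<tau>. \<tau> \<subseteq> V \<Longrightarrow> card \<tau> = i \<Longrightarrow> bd c \<tau> - f * d \<tau> \<in> J"
    by metis
  obtain e where e: "\<And>\<sigma>. e \<sigma> \<in> S"
    and de: "\<And>\<sigma>. \<sigma> \<subseteq> V \<Longrightarrow> card \<sigma> = i \<Longrightarrow> d \<sigma> - bd e \<sigma> \<in> J"
  proof (rule acyclicE[OF ac(1), of d])
    fix \<tau> assume \<tau>: "\<tau> \<subseteq> V" "Suc (card \<tau>) = i"
    have "bd (\<lambda>\<sigma>. bd c \<sigma> - f * d \<sigma>) \<tau> \<in> J"
      using \<tau> card_insert_V by (intro bd_in_ideal[OF J] cd) auto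
    then have "- (f * bd d \<tau>) \<in> J"
      by (simp add: bd_diff bd_scale bd_bd[OF \<tau>(1)])
    from ideal_uminus[OF J this] show "bd d \<tau> \<in> J"
      using reg bd_mem[of d, OF d] by (auto simp: regular_on_def)
  qed (use d in blast)+
  obtain b where b: "\<And>\<sigma>. b \<sigma> \<in> S"
    and cb: "\<And>\<sigma>. \<sigma> \<subseteq> V \<Longrightarrow> card \<sigma> = Suc i \<Longrightarrow> c \<sigma> - f * e \<sigma> - bd b \<sigma> \<in> J"
  proof (rule acyclicE[OF ac(2), of "\<lambda>\<sigma>. c \<sigma> - f * e \<sigma>"])
    show "c \<sigma> - f * e \<sigma> \<in> S" for \<sigma> by (intro diff_mem mult_mem c e f)
    fix \<tau> assume \<tau>: "\<tau> \<subseteq> V" "Suc (card \<tau>) = Suc i"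
    have "bd c \<tau> - f * d \<tau> + f * (d \<tau> - bd e \<tau>) \<in> J"
      using \<tau> by (intro ideal_add[OF J] ideal_mult[OF J] cd de f) auto
    then show "bd (\<lambda>\<sigma>. c \<sigma> - f * e \<sigma>) \<tau> \<in> J"
      by (simp add: bd_diff bd_scale algebra_simps)
  qed blast
  show "\<exists>b. (\<forall>\<sigma>. b \<sigma> \<in> S) \<and> (\<forall>\<sigma>\<subseteq>V. card \<sigma> = Suc i \<longrightarrow> c \<sigma> - bd b \<sigma> \<in> adjoin J f)"
  proof (intro exI[of _ b] conjI allI impI b)
    fix \<sigma> assume \<sigma>: "\<sigma> \<subseteq> V" "card \<sigma> = Suc i"
    have "c \<sigma> - bd b \<sigma> = (c \<sigma> - f * e \<sigma> - bd b \<sigma>) + f * e \<sigma>" by simp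
    then show "c \<sigma> - bd b \<sigma> \<in> adjoin J f"
      using adjoinI[OF cb[OF \<sigma>] e[of \<sigma>], of f] by simp
  qed
qed

end

section \<open>Depth and the vanishing of Koszul homology\<close>

context koszul_complex
begin

lemma var_idealE:
  assumes "f \<in> var_ideal"
  obtains g where "\<And>v. g v \<in> S" "f = (\<Sum>v\<in>V. g v * x v)"
  using assms by (auto simp: var_ideal_def)

lemma var_idealI: "(\<And>v. v \<in> V \<Longrightarrow> g v \<in> S) \<Longrightarrow> (\<Sum>v\<in>V. g v * x v) \<in> var_ideal"
  unfolding var_ideal_def
  by (rule CollectI, rule exI[of _ "\<lambda>v. if v \<in> V then g v else 0"]) (auto simp: zero_mem)

lemma ideal_var_ideal: "ideal var_ideal R"
  unfolding ideal_iff
proof (intro conjI ballI)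
  show "var_ideal \<subseteq> S"
    by (auto simp: var_ideal_def intro!: sum_mem mult_mem x_mem)
  show "0 \<in> var_ideal"
    using var_idealI[of "\<lambda>_. 0"] zero_mem by simp
next
  fix a b assume "a \<in> var_ideal" "b \<in> var_ideal"
  from \<open>a \<in> var_ideal\<close> obtain g where g: "\<And>v. g v \<in> S" "a = (\<Sum>v\<in>V. g v * x v)"
    by (rule var_idealE) blast
  from \<open>b \<in> var_ideal\<close> obtain h where h: "\<And>v. h v \<in> S" "b = (\<Sum>v\<in>V. h v * x v)"
    by (rule var_idealE) blast
  have "a + b = (\<Sum>v\<in>V. (g v + h v) * x v)"
    by (simp add: g(2) h(2) distrib_right sum.distrib)
  then show "a + b \<in> var_ideal"
    using var_idealI[of "\<lambda>v. g v + h v"] g(1) h(1) add_mem by simp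
next
  fix a s assume "a \<in> var_ideal" and s: "s \<in> S"
  from \<open>a \<in> var_ideal\<close> obtain g where g: "\<And>v. g v \<in> S" "a = (\<Sum>v\<in>V. g v * x v)"
    by (rule var_idealE) blast
  have "s * a = (\<Sum>v\<in>V. (s * g v) * x v)"
    by (simp add: g(2) sum_distrib_left mult.assoc)
  then show "s * a \<in> var_ideal"
    using var_idealI[of "\<lambda>v. s * g v"] g(1) s mult_mem by simp
qed

lemma x_in_var_ideal: "v \<in> V \<Longrightarrow> x v \<in> var_ideal"
proof -
  assume v: "v \<in> V"
  have "(\<Sum>w\<in>V. (if w = v then 1 else 0) * x w) = (\<Sum>w\<in>V. if w = v then x w else 0)"
    by (intro sum.cong) auto
  also have "\<dots> = x v"
    using v finite_V by simp
  finally show ?thesis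
    using var_idealI[of "\<lambda>w. if w = v then 1 else 0"] one_mem zero_mem by simp
qed

lemma var_ideal_minimal:
  assumes K: "ideal K R" and "\<And>v. v \<in> V \<Longrightarrow> x v \<in> K"
  shows "var_ideal \<subseteq> K"
  using assms by (auto simp: var_ideal_def intro!: ideal_sum[OF K] ideal_mult[OF K])

lemma acyclic_beyond_card:
  assumes "card V < i"
  shows "acyclic J i"
proof -
  have "card \<sigma> \<noteq> i" if "\<sigma> \<subseteq> V" for \<sigma>
    using card_mono[OF finite_V that] assms by simp
  then show ?thesis
    using zero_mem unfolding koszul_acyclic_def by blast
qed

text \<open>
  The top homology is the submodule of \<open>S / J\<close> annihilated by all variables.
\<close>

lemma socle_trivial_of_acyclic_top:
  assumes J: "ideal J R" and ac: "acyclic J (card V)"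
    and p: "p \<in> S" "\<And>v. v \<in> V \<Longrightarrow> x v * p \<in> J"
  shows "p \<in> J"
proof -
  obtain b where "\<And>\<sigma>. b \<sigma> \<in> S" and "\<And>\<sigma>. \<sigma> \<subseteq> V \<Longrightarrow> card \<sigma> = card V \<Longrightarrow> p - bd b \<sigma> \<in> J"
  proof (rule acyclicE[OF ac, of "\<lambda>_. p"])
    fix \<tau> show "bd (\<lambda>_. p) \<tau> \<in> J"
      unfolding koszul_boundary_def mult.assoc
      using p(2) by (intro ideal_sum[OF J] ideal_mult[OF J _ sg_mem]) auto
  qed (use p in auto)
  from this(2)[of V] show ?thesis by (simp add: koszul_boundary_def)
qed

text \<open>
  The homology in degree 0 is \<open>S\<close> modulo \<open>J\<close> and the variables.
\<close>

lemma not_acyclic_0: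
  assumes "J \<subseteq> var_ideal" and 1: "1 \<notin> var_ideal"
  shows "\<not> acyclic J 0"
proof
  assume ac: "acyclic J 0"
  obtain b where b: "\<And>\<sigma>. b \<sigma> \<in> S" and "\<And>\<sigma>. \<sigma> \<subseteq> V \<Longrightarrow> card \<sigma> = 0 \<Longrightarrow> 1 - bd b \<sigma> \<in> J"
  proof (rule acyclicE[OF ac, of "\<lambda>_. 1"])
    show "1 \<in> S" by (rule one_mem)
    show "bd (\<lambda>_. 1) \<tau> \<in> J" if "Suc (card \<tau>) = 0" for \<tau>
      using that by simp
  qed blast
  from this(2)[of "{}"] have "1 - bd b {} \<in> var_ideal" using assms by auto
  moreover have "bd b {} \<in> var_ideal"
    using var_idealI[of "\<lambda>v. sg v {} * b {v}"] b mult_mem sg_mem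
    by (simp add: koszul_boundary_def mult_ac)
  ultimately show False
    using 1 ideal_diff_cancel[OF ideal_var_ideal] by blast
qed

text \<open>
  Beyond the number of variables the homology vanishes for every ideal; removing an element of the
  sequence extends the range of vanishing downwards by one degree.
\<close>

lemma acyclic_of_regular_seq:
  assumes "ideal J R" "set fs \<subseteq> var_ideal" "regular_seq_on J fs" "card V < i + length fs"
  shows "acyclic J i"
  using assms
proof (induction fs arbitrary: J i)
  case Nil
  then show ?case by (simp add: acyclic_beyond_card)
next
  case (Cons f fs)
  have f: "f \<in> S" "f \<in> var_ideal"
    using Cons.prems(2) ideal_subset[OF ideal_var_ideal] by auto
  show ?case
  proof (rule acyclic_of_adjoin[OF Cons.prems(1) f(2)])
    show "regular_on J f"
      using Cons.prems(3) by simp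
    show "acyclic (adjoin J f) (Suc i)"
    proof (rule Cons.IH)
      show "ideal (adjoin J f) R" by (rule ideal_adjoin[OF Cons.prems(1) f(1)])
    qed (use Cons.prems in auto)
  qed
qed

text \<open>
  Vanishing in the top degree means that no non-zero element of \<open>S / J\<close> is annihilated by the
  variables, which provides a first non-zero-divisor \<open>f\<close>; passing to \<open>(J, f)\<close> costs one degree.
\<close>

lemma regular_seq_of_acyclic:
  assumes max: "ideal_maximum_condition I" and 1: "1 \<notin> var_ideal"
    and "ideal J R" "I \<subseteq> J" "J \<subseteq> var_ideal" "\<And>i. card V < i + d \<Longrightarrow> acyclic J i"
  shows "\<exists>fs. length fs = d \<and> set fs \<subseteq> var_ideal \<and> regular_seq_on J fs"
  using assms(3-)
proof (induction d arbitrary: J)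
  case 0
  then show ?case by auto
next
  case (Suc d)
  note J = Suc.prems(1)
  have "\<exists>f\<in>var_ideal. regular_on J f"
  proof (rule exists_regular_element[OF J Suc.prems(2) max ideal_var_ideal])
    fix p assume p: "p \<in> S" and fp: "\<And>f. f \<in> var_ideal \<Longrightarrow> f * p \<in> J"
    show "p \<in> J"
    proof (rule socle_trivial_of_acyclic_top[OF J _ p])
      show "acyclic J (card V)" by (rule Suc.prems(4)) simp
      show "x v * p \<in> J" if "v \<in> V" for v
        by (rule fp[OF x_in_var_ideal[OF that]])
    qed
  qed
  then obtain f where f: "f \<in> var_ideal" and reg: "regular_on J f" by auto
  have fS: "f \<in> S" using f ideal_subset[OF ideal_var_ideal] by auto
  have "\<exists>fs. length fs = d \<and> set fs \<subseteq> var_ideal \<and> regular_seq_on (adjoin J f) fs"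
  proof (rule Suc.IH)
    show "ideal (adjoin J f) R" by (rule ideal_adjoin[OF J fS])
    show "I \<subseteq> adjoin J f" using Suc.prems(2) adjoin_subset by blast
    show "adjoin J f \<subseteq> var_ideal"
      using f Suc.prems(3)
      by (auto elim!: adjoinE intro!: ideal_add[OF ideal_var_ideal] ideal_mult_right[OF ideal_var_ideal])
    show "acyclic (adjoin J f) i" if i: "card V < i + d" for i
    proof (cases i)
      case 0
      then show ?thesis
        using Suc.prems(4)[of 0] not_acyclic_0[OF Suc.prems(3) 1] i by simp
    next
      case (Suc j)
      then show ?thesis
        using Suc.prems(4)[of j] Suc.prems(4)[of i] i by (simp add: adjoin_acyclic[OF J fS reg])
    qed
  qed
  then obtain fs where "length fs = d" "set fs \<subseteq> var_ideal" "regular_seq_on (adjoin J f) fs" by auto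
  then show ?case
    using f reg by (intro exI[of _ "f # fs"]) auto
qed

end

section \<open>Koszul homology under restriction and colon\<close>

definition ring_endo :: "('a::comm_ring_1 \<Rightarrow> 'a) \<Rightarrow> bool" where
  "ring_endo \<rho> \<longleftrightarrow> (\<forall>a b. \<rho> (a + b) = \<rho> a + \<rho> b) \<and> (\<forall>a b. \<rho> (a * b) = \<rho> a * \<rho> b) \<and> \<rho> 1 = 1"

context
  fixes \<rho> :: "'a::comm_ring_1 \<Rightarrow> 'a"
  assumes \<rho>: "ring_endo \<rho>"
begin

lemma ring_endo_add: "\<rho> (a + b) = \<rho> a + \<rho> b"
  and ring_endo_mult: "\<rho> (a * b) = \<rho> a * \<rho> b"
  and ring_endo_one: "\<rho> 1 = 1"
  using \<rho> by (auto simp: ring_endo_def)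

lemma ring_endo_zero: "\<rho> 0 = 0"
  using ring_endo_add[of 0 0] by simp

lemma ring_endo_uminus: "\<rho> (- a) = - \<rho> a"
  using ring_endo_add[of a "- a"] ring_endo_zero by (simp add: minus_unique)

lemma ring_endo_diff: "\<rho> (a - b) = \<rho> a - \<rho> b"
  using ring_endo_add[of a "- b"] ring_endo_uminus by simp

lemma ring_endo_sum: "\<rho> (sum f A) = (\<Sum>i\<in>A. \<rho> (f i))"
  by (induction A rule: infinite_finite_induct) (auto simp: ring_endo_zero ring_endo_add)

lemma ring_endo_sign: "\<rho> (koszul_sign rank v \<tau>) = koszul_sign rank v \<tau>"
  by (cases "even (card {w \<in> \<tau>. rank w < rank v})")
    (auto simp: koszul_sign_def ring_endo_one ring_endo_uminus)

lemmas ring_endo_simps = ring_endo_add ring_endo_mult ring_endo_one ring_endo_zero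
  ring_endo_uminus ring_endo_diff ring_endo_sum ring_endo_sign

end

lemma koszul_acyclicD:
  assumes "koszul_acyclic rank x S V J i"
    and "(\<forall>\<sigma>. c \<sigma> \<in> S) \<and> (\<forall>\<tau>\<subseteq>V. Suc (card \<tau>) = i \<longrightarrow> koszul_boundary rank x V c \<tau> \<in> J)"
  shows "\<exists>b. (\<forall>\<sigma>. b \<sigma> \<in> S) \<and> (\<forall>\<sigma>\<subseteq>V. card \<sigma> = i \<longrightarrow> c \<sigma> - koszul_boundary rank x V b \<sigma> \<in> J)"
  using assms(1)[unfolded koszul_acyclic_def, THEN spec, THEN mp, OF assms(2)] .

lemma (in koszul_complex) acyclic_cong:
  assumes "\<And>s. s \<in> S \<Longrightarrow> s \<in> J \<longleftrightarrow> s \<in> J'" and "acyclic J i"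
  shows "acyclic J' i"
proof (rule acyclicI)
  fix c assume c: "\<And>\<sigma>. c \<sigma> \<in> S"
    and cyc: "\<And>\<tau>. \<tau> \<subseteq> V \<Longrightarrow> Suc (card \<tau>) = i \<Longrightarrow> bd c \<tau> \<in> J'"
  obtain b where b: "\<And>\<sigma>. b \<sigma> \<in> S" and cb: "\<And>\<sigma>. \<sigma> \<subseteq> V \<Longrightarrow> card \<sigma> = i \<Longrightarrow> c \<sigma> - bd b \<sigma> \<in> J"
  proof (rule acyclicE[OF assms(2), of c])
    show "bd c \<tau> \<in> J" if "\<tau> \<subseteq> V" "Suc (card \<tau>) = i" for \<tau>
      using assms(1)[OF bd_mem[of c \<tau>, OF c]] cyc[OF that] by simp
  qed (rule c, blast)
  show "\<exists>b. (\<forall>\<sigma>. b \<sigma> \<in> S) \<and> (\<forall>\<sigma>\<subseteq>V. card \<sigma> = i \<longrightarrow> c \<sigma> - bd b \<sigma> \<in> J')"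
  proof (intro exI[of _ b] conjI allI impI b)
    show "c \<sigma> - bd b \<sigma> \<in> J'" if "\<sigma> \<subseteq> V" "card \<sigma> = i" for \<sigma>
      using assms(1)[OF diff_mem[OF c[of \<sigma>] bd_mem[of b \<sigma>, OF b]]] cb[OF that] by simp
  qed
qed

text \<open>
  The model is the substitution \<open>u = 0\<close> in a polynomial ring: a ring endomorphism whose image
  \<open>{s \<in> S. \<rho> s = s}\<close> is the polynomial ring in the remaining variables.
\<close>

locale koszul_retract = koszul_complex S V x rank
  for S :: "'a::comm_ring_1 set" and V :: "'v set" and x rank +
  fixes u :: 'v and \<rho> :: "'a \<Rightarrow> 'a"
  assumes u_mem: "u \<in> V"
    and endo: "ring_endo \<rho>"
    and \<rho>_x_u: "\<rho> (x u) = 0"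
    and \<rho>_x: "\<And>v. v \<in> V - {u} \<Longrightarrow> \<rho> (x v) = x v"
    and \<rho>_mem: "\<And>s. s \<in> S \<Longrightarrow> \<rho> s \<in> S"
    and \<rho>_congruent: "\<And>s. s \<in> S \<Longrightarrow> \<exists>t\<in>S. s = \<rho> s + x u * t"
begin

abbreviation bd' :: "('v set \<Rightarrow> 'a) \<Rightarrow> 'v set \<Rightarrow> 'a" where
  "bd' \<equiv> koszul_boundary rank x (V - {u})"

lemmas \<rho>_simps = ring_endo_simps[OF endo]

lemma \<rho>_idem: "s \<in> S \<Longrightarrow> \<rho> (\<rho> s) = \<rho> s"
proof -
  assume "s \<in> S"
  then obtain t where "s = \<rho> s + x u * t"
    using \<rho>_congruent by blast
  then have "\<rho> s = \<rho> (\<rho> s + x u * t)" by simp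
  then show ?thesis by (simp add: \<rho>_simps \<rho>_x_u)
qed

lemma bd_split:
  assumes "u \<notin> \<sigma>"
  shows "bd c \<sigma> = bd' c \<sigma> + sg u \<sigma> * x u * c (insert u \<sigma>)"
proof -
  have "V - \<sigma> = insert u (V - {u} - \<sigma>)" using assms u_mem by auto
  then show ?thesis using finite_V by (simp add: koszul_boundary_def add.commute)
qed

lemma bd_insert: "bd c (insert u \<tau>) = bd' c (insert u \<tau>)"
proof -
  have "V - insert u \<tau> = V - {u} - insert u \<tau>" by auto
  then show ?thesis by (simp add: koszul_boundary_def)
qed

lemma bd'_insert:
  assumes "u \<notin> \<tau>"
  shows "bd' c (insert u \<tau>) =
    (\<Sum>v\<in>V - {u} - \<tau>. sg v (insert u \<tau>) * x v * c (insert u (insert v \<tau>)))"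
proof -
  have "V - {u} - insert u \<tau> = V - {u} - \<tau>" by auto
  then show ?thesis by (simp add: koszul_boundary_def insert_commute)
qed

lemma \<rho>_bd: "\<rho> (bd c \<sigma>) = bd' (\<lambda>\<sigma>. \<rho> (c \<sigma>)) \<sigma>"
proof -
  have "\<rho> (bd c \<sigma>) = (\<Sum>v\<in>V - \<sigma>. sg v \<sigma> * \<rho> (x v) * \<rho> (c (insert v \<sigma>)))"
    by (simp add: koszul_boundary_def \<rho>_simps)
  also have "\<dots> = bd' (\<lambda>\<sigma>. \<rho> (c \<sigma>)) \<sigma>"
    unfolding koszul_boundary_def
    using finite_V \<rho>_x_u by (intro sum.mono_neutral_cong_right) (auto simp: \<rho>_x)
  finally show ?thesis .
qed

text \<open>
  A cycle without the variable \<open>u\<close> is also a cycle of the larger complex. If it bounds there, then \<open>\<rho>\<close>,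
  applied to the coefficients, kills the part of the boundary that involves \<open>u\<close>.
\<close>

lemma acyclic_restrict:
  assumes J: "ideal J R" and \<rho>J: "\<And>s. s \<in> J \<Longrightarrow> \<rho> s \<in> J" and ac: "acyclic J i"
  shows "koszul_acyclic rank x {s \<in> S. \<rho> s = s} (V - {u}) J i"
  unfolding koszul_acyclic_def
proof (intro allI impI, elim conjE)
  fix c
  assume c: "\<forall>\<sigma>. c \<sigma> \<in> {s \<in> S. \<rho> s = s}"
    and cyc: "\<forall>\<tau>\<subseteq>V - {u}. Suc (card \<tau>) = i \<longrightarrow> bd' c \<tau> \<in> J"
  define c' where "c' \<sigma> = (if u \<in> \<sigma> then 0 else c \<sigma>)" for \<sigma>
  obtain b where b: "\<And>\<sigma>. b \<sigma> \<in> S" and cb: "\<And>\<sigma>. \<sigma> \<subseteq> V \<Longrightarrow> card \<sigma> = i \<Longrightarrow> c' \<sigma> - bd b \<sigma> \<in> J"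
  proof (rule acyclicE[OF ac, of c'])
    show "c' \<sigma> \<in> S" for \<sigma> using c zero_mem by (simp add: c'_def)
    fix \<tau> assume \<tau>: "\<tau> \<subseteq> V" "Suc (card \<tau>) = i"
    show "bd c' \<tau> \<in> J"
    proof (cases "u \<in> \<tau>")
      case True
      then show ?thesis using ideal_zero[OF J] by (simp add: koszul_boundary_def c'_def)
    next
      case False
      have "bd' c' \<tau> = bd' c \<tau>"
        unfolding koszul_boundary_def
      proof (intro sum.cong refl)
        fix v assume "v \<in> V - {u} - \<tau>"
        then have "u \<notin> insert v \<tau>" using False by auto
        then show "sg v \<tau> * x v * c' (insert v \<tau>) = sg v \<tau> * x v * c (insert v \<tau>)"
          by (simp add: c'_def)
      qed
      then have "bd c' \<tau> = bd' c \<tau>"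
        by (simp add: bd_split[OF False] c'_def)
      then show ?thesis using cyc \<tau> False by auto
    qed
  qed blast
  show "\<exists>b. (\<forall>\<sigma>. b \<sigma> \<in> {s \<in> S. \<rho> s = s}) \<and>
      (\<forall>\<sigma>\<subseteq>V - {u}. card \<sigma> = i \<longrightarrow> c \<sigma> - bd' b \<sigma> \<in> J)"
  proof (intro exI[of _ "\<lambda>\<sigma>. \<rho> (b \<sigma>)"] conjI allI impI)
    show "\<rho> (b \<sigma>) \<in> {s \<in> S. \<rho> s = s}" for \<sigma>
      using b \<rho>_mem \<rho>_idem by simp
    fix \<sigma> assume \<sigma>: "\<sigma> \<subseteq> V - {u}" "card \<sigma> = i"
    have "\<sigma> \<subseteq> V" using \<sigma>(1) by auto
    from \<rho>J[OF cb[OF this \<sigma>(2)]] have "\<rho> (c' \<sigma>) - bd' (\<lambda>\<sigma>. \<rho> (b \<sigma>)) \<sigma> \<in> J"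
      by (simp add: \<rho>_simps(6) \<rho>_bd)
    moreover have "\<rho> (c' \<sigma>) = c \<sigma>"
      using c \<sigma>(1) by (auto simp: c'_def)
    ultimately show "c \<sigma> - bd' (\<lambda>\<sigma>. \<rho> (b \<sigma>)) \<sigma> \<in> J" by simp
  qed
qed

text \<open>
  Multiplication by \<open>u\<close> embeds \<open>S / (J : u)\<close> into \<open>S / J\<close> with cokernel \<open>S / (J, u)\<close>. So a cycle \<open>c\<close> modulo
  \<open>J : u\<close> gives the cycle \<open>u c\<close> modulo \<open>J\<close>, which is the boundary of some \<open>e\<close>, and \<open>e\<close> is a cycle modulo
  \<open>(J, u)\<close>. As \<open>u\<close> acts as zero on \<open>S / (J, u)\<close>, the Koszul complex of this module is a direct sum of two
  copies of the complex without \<open>u\<close>, one of them shifted by one degree; both have no homology in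
  degree \<open>i + 1\<close> of the sum by \<open>acyclic_restrict\<close>. Hence \<open>e\<close> can be corrected by a boundary to become divisible by \<open>u\<close>.
\<close>

lemma acyclic_colon:
  assumes J: "ideal J R" and \<rho>J: "\<And>s. s \<in> J \<Longrightarrow> \<rho> s \<in> J"
    and ac: "acyclic J i" "acyclic J (Suc i)"
  shows "acyclic (colon J (x u)) i"
proof (rule acyclicI)
  let ?S = "{s \<in> S. \<rho> s = s}"
  note fin = finite_subset[OF _ finite_V]
  have restr: "koszul_acyclic rank x ?S (V - {u}) J i" "koszul_acyclic rank x ?S (V - {u}) J (Suc i)"
    by (rule acyclic_restrict[OF J \<rho>J ac(1)], assumption)
       (rule acyclic_restrict[OF J \<rho>J ac(2)], assumption)
  have xu: "x u \<in> S" by (rule x_mem[OF u_mem])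
  fix c assume c: "\<And>\<sigma>. c \<sigma> \<in> S"
    and cyc: "\<And>\<tau>. \<tau> \<subseteq> V \<Longrightarrow> Suc (card \<tau>) = i \<Longrightarrow> bd c \<tau> \<in> colon J (x u)"
  obtain e where e: "\<And>\<sigma>. e \<sigma> \<in> S"
    and ce: "\<And>\<sigma>. \<sigma> \<subseteq> V \<Longrightarrow> card \<sigma> = i \<Longrightarrow> x u * c \<sigma> - bd e \<sigma> \<in> J"
  proof (rule acyclicE[OF ac(1), of "\<lambda>\<sigma>. x u * c \<sigma>"])
    show "x u * c \<sigma> \<in> S" for \<sigma> by (intro mult_mem xu c)
    show "bd (\<lambda>\<sigma>. x u * c \<sigma>) \<tau> \<in> J" if "\<tau> \<subseteq> V" "Suc (card \<tau>) = i" for \<tau>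
      using cyc[OF that] unfolding bd_scale colon_def by (simp add: mult.commute)
  qed blast
  have \<rho>e: "bd' (\<lambda>\<sigma>. \<rho> (e \<sigma>)) \<sigma> \<in> J" if "\<sigma> \<subseteq> V" "card \<sigma> = i" for \<sigma>
  proof -
    have "- bd' (\<lambda>\<sigma>. \<rho> (e \<sigma>)) \<sigma> \<in> J"
      using \<rho>J[OF ce[OF that]] by (simp add: \<rho>_simps(2,6) \<rho>_bd \<rho>_x_u)
    then show ?thesis using ideal_uminus[OF J] by fastforce
  qed
  \<comment> \<open>The summand without \<open>u\<close>: subsets that do not contain \<open>u\<close>.\<close>
  obtain g0 where g0: "\<And>\<sigma>. g0 \<sigma> \<in> ?S"
    and eg0: "\<And>\<sigma>. \<sigma> \<subseteq> V - {u} \<Longrightarrow> card \<sigma> = Suc i \<Longrightarrow> \<rho> (e \<sigma>) - bd' g0 \<sigma> \<in> J"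
  proof -
    have "(\<forall>\<sigma>. \<rho> (e \<sigma>) \<in> ?S) \<and>
        (\<forall>\<tau>\<subseteq>V - {u}. Suc (card \<tau>) = Suc i \<longrightarrow> bd' (\<lambda>\<sigma>. \<rho> (e \<sigma>)) \<tau> \<in> J)"
    proof (intro conjI allI impI)
      show "\<rho> (e \<sigma>) \<in> ?S" for \<sigma> using e \<rho>_mem \<rho>_idem by simp
      show "bd' (\<lambda>\<sigma>. \<rho> (e \<sigma>)) \<tau> \<in> J" if "\<tau> \<subseteq> V - {u}" "Suc (card \<tau>) = Suc i" for \<tau>
        by (rule \<rho>e) (use that in auto)
    qed
    from koszul_acyclicD[OF restr(2) this] obtain b where "\<forall>\<sigma>. b \<sigma> \<in> ?S"
      "\<forall>\<sigma>\<subseteq>V - {u}. card \<sigma> = Suc i \<longrightarrow> \<rho> (e \<sigma>) - bd' b \<sigma> \<in> J"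
      by (elim exE conjE)
    then show ?thesis by (intro that[of b]) simp_all
  qed
  \<comment> \<open>The shifted summand: subsets that contain \<open>u\<close>; the sign makes \<open>e1\<close> a cycle for \<open>bd'\<close>.\<close>
  define e1 where "e1 \<sigma> = sg u \<sigma> * \<rho> (e (insert u \<sigma>))" for \<sigma>
  have e1: "bd' e1 \<tau> = - (sg u \<tau> * bd' (\<lambda>\<sigma>. \<rho> (e \<sigma>)) (insert u \<tau>))" if \<tau>: "\<tau> \<subseteq> V - {u}" for \<tau>
  proof -
    have "u \<notin> \<tau>" using \<tau> by auto
    have "bd' e1 \<tau> = (\<Sum>v\<in>V - {u} - \<tau>. - (sg u \<tau> *
        (sg v (insert u \<tau>) * x v * \<rho> (e (insert u (insert v \<tau>))))))"
      unfolding koszul_boundary_def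
    proof (intro sum.cong refl)
      fix v assume v: "v \<in> V - {u} - \<tau>"
      have s: "sg u (insert v \<tau>) * sg v \<tau> = - (sg v (insert u \<tau>) * sg u \<tau>)"
        using v \<tau> fin[of \<tau>] rank_neq[OF u_mem, of v] by (intro koszul_sign_swap) auto
      have "sg v \<tau> * x v * e1 (insert v \<tau>) =
          (sg u (insert v \<tau>) * sg v \<tau>) * (x v * \<rho> (e (insert u (insert v \<tau>))))"
        by (simp add: e1_def mult_ac)
      then show "sg v \<tau> * x v * e1 (insert v \<tau>) =
          - (sg u \<tau> * (sg v (insert u \<tau>) * x v * \<rho> (e (insert u (insert v \<tau>)))))"
        unfolding s by (simp add: mult_ac)
    qed
    then show ?thesis
      by (simp add: bd'_insert[OF \<open>u \<notin> \<tau>\<close>] sum_negf sum_distrib_left)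
  qed
  obtain g1 where g1: "\<And>\<sigma>. g1 \<sigma> \<in> ?S"
    and eg1: "\<And>\<sigma>. \<sigma> \<subseteq> V - {u} \<Longrightarrow> card \<sigma> = i \<Longrightarrow> e1 \<sigma> - bd' g1 \<sigma> \<in> J"
  proof -
    have e1S: "e1 \<sigma> \<in> ?S" for \<sigma>
      unfolding e1_def using \<rho>_mem[OF e] \<rho>_idem[OF e] by (simp add: \<rho>_simps mult_mem sg_mem)
    have "bd' e1 \<tau> \<in> J" if \<tau>: "\<tau> \<subseteq> V - {u}" "Suc (card \<tau>) = i" for \<tau>
    proof -
      have "card (insert u \<tau>) = i" using \<tau> fin[of \<tau>] by (subst card_insert_disjoint) auto
      then have "bd' (\<lambda>\<sigma>. \<rho> (e \<sigma>)) (insert u \<tau>) \<in> J"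
        using \<tau>(1) u_mem by (intro \<rho>e) auto
      then show ?thesis
        unfolding e1[OF \<tau>(1)] by (rule ideal_uminus[OF J ideal_mult[OF J _ sg_mem]])
    qed
    then have "(\<forall>\<sigma>. e1 \<sigma> \<in> ?S) \<and> (\<forall>\<tau>\<subseteq>V - {u}. Suc (card \<tau>) = i \<longrightarrow> bd' e1 \<tau> \<in> J)"
      using e1S by blast
    from koszul_acyclicD[OF restr(1) this] obtain b where "\<forall>\<sigma>. b \<sigma> \<in> ?S"
      "\<forall>\<sigma>\<subseteq>V - {u}. card \<sigma> = i \<longrightarrow> e1 \<sigma> - bd' b \<sigma> \<in> J"
      by (elim exE conjE)
    then show ?thesis by (intro that[of b]) simp_all
  qed
  \<comment> \<open>The bounding chains of the two summands, put together.\<close>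
  define g where "g \<sigma> = (if u \<in> \<sigma> then - (sg u (\<sigma> - {u}) * g1 (\<sigma> - {u})) else g0 \<sigma>)" for \<sigma>
  have g: "g \<sigma> \<in> S" for \<sigma>
    using g0 g1 by (auto simp: g_def intro!: uminus_mem mult_mem sg_mem)
  have "\<exists>t\<in>S. e \<sigma> - bd g \<sigma> - x u * t \<in> J" if \<sigma>: "\<sigma> \<subseteq> V" "card \<sigma> = Suc i" for \<sigma>
  proof -
    obtain t0 where t0: "t0 \<in> S" "e \<sigma> = \<rho> (e \<sigma>) + x u * t0"
      using \<rho>_congruent[OF e[of \<sigma>]] by blast
    show ?thesis
    proof (cases "u \<in> \<sigma>")
      case False
      have "bd' g \<sigma> = bd' g0 \<sigma>"
        using False unfolding koszul_boundary_def by (intro sum.cong) (auto simp: g_def)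
      then have "e \<sigma> - bd g \<sigma> - x u * (t0 - sg u \<sigma> * g (insert u \<sigma>)) = \<rho> (e \<sigma>) - bd' g0 \<sigma>"
        by (subst t0(2)) (simp add: bd_split[OF False] algebra_simps)
      moreover have "\<rho> (e \<sigma>) - bd' g0 \<sigma> \<in> J"
        using False \<sigma> by (intro eg0) auto
      moreover have "t0 - sg u \<sigma> * g (insert u \<sigma>) \<in> S"
        by (intro diff_mem mult_mem sg_mem g t0)
      ultimately show ?thesis by metis
    next
      case True
      define \<tau> where "\<tau> = \<sigma> - {u}"
      have \<tau>: "\<sigma> = insert u \<tau>" "u \<notin> \<tau>" "\<tau> \<subseteq> V - {u}" "card \<tau> = i"
        using True \<sigma> fin[OF \<sigma>(1)] by (auto simp: \<tau>_def)
      have "bd g \<sigma> = (\<Sum>v\<in>V - {u} - \<tau>. sg u \<tau> * (sg v \<tau> * x v * g1 (insert v \<tau>)))"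
        unfolding \<tau>(1) bd_insert bd'_insert[OF \<tau>(2)]
      proof (intro sum.cong refl)
        fix v assume v: "v \<in> V - {u} - \<tau>"
        have s: "sg v (insert u \<tau>) * sg u (insert v \<tau>) = - (sg u \<tau> * sg v \<tau>)"
          using v \<tau>(2,3) fin[of \<tau>] rank_neq[OF u_mem, of v] by (intro koszul_sign_swap') auto
        have "insert u (insert v \<tau>) - {u} = insert v \<tau>" using v \<tau>(2) by auto
        then have "sg v (insert u \<tau>) * x v * g (insert u (insert v \<tau>)) =
            - ((sg v (insert u \<tau>) * sg u (insert v \<tau>)) * (x v * g1 (insert v \<tau>)))"
          by (simp add: g_def mult_ac)
        then show "sg v (insert u \<tau>) * x v * g (insert u (insert v \<tau>)) =
            sg u \<tau> * (sg v \<tau> * x v * g1 (insert v \<tau>))"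
          unfolding s by (simp add: mult_ac)
      qed
      then have bdg: "bd g \<sigma> = sg u \<tau> * bd' g1 \<tau>"
        by (simp add: koszul_boundary_def sum_distrib_left)
      have "sg u \<tau> * (e1 \<tau> - bd' g1 \<tau>) \<in> J"
        by (intro ideal_mult[OF J] eg1 \<tau> sg_mem)
      moreover have "sg u \<tau> * (e1 \<tau> - bd' g1 \<tau>) = \<rho> (e \<sigma>) - bd g \<sigma>"
        by (simp add: bdg e1_def right_diff_distrib flip: \<tau>(1))
      moreover have "\<rho> (e \<sigma>) - bd g \<sigma> = e \<sigma> - bd g \<sigma> - x u * t0"
        by (subst (2) t0(2)) simp
      ultimately show ?thesis using t0(1) by metis
    qed
  qed
  then have "\<forall>\<sigma>. \<exists>t. t \<in> S \<and> (\<sigma> \<subseteq> V \<and> card \<sigma> = Suc i \<longrightarrow> e \<sigma> - bd g \<sigma> - x u * t \<in> J)"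
    using zero_mem by blast
  then obtain t where t: "\<And>\<sigma>. t \<sigma> \<in> S"
    and et: "\<And>\<sigma>. \<sigma> \<subseteq> V \<Longrightarrow> card \<sigma> = Suc i \<Longrightarrow> e \<sigma> - bd g \<sigma> - x u * t \<sigma> \<in> J"
    by metis
  show "\<exists>b. (\<forall>\<sigma>. b \<sigma> \<in> S) \<and> (\<forall>\<sigma>\<subseteq>V. card \<sigma> = i \<longrightarrow> c \<sigma> - bd b \<sigma> \<in> colon J (x u))"
  proof (intro exI[of _ t] conjI allI impI t)
    fix \<sigma> assume \<sigma>: "\<sigma> \<subseteq> V" "card \<sigma> = i"
    have "bd (\<lambda>\<sigma>. e \<sigma> - bd g \<sigma> - x u * t \<sigma>) \<sigma> \<in> J"
      using \<sigma> card_insert_V by (intro bd_in_ideal[OF J] et) auto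
    then have "bd e \<sigma> - x u * bd t \<sigma> \<in> J"
      by (simp add: bd_diff bd_scale bd_bd[OF \<sigma>(1)])
    from ideal_add[OF J ce[OF \<sigma>] this] have "(c \<sigma> - bd t \<sigma>) * x u \<in> J"
      by (simp add: algebra_simps)
    then show "c \<sigma> - bd t \<sigma> \<in> colon J (x u)"
      using diff_mem[OF c bd_mem[OF t]] by (simp add: colon_def)
  qed
qed

end

section \<open>Depth of a quotient ring\<close>

lemma (in ideal) quot_carrier: "carrier (R Quot I) = (\<lambda>p. I +> p) ` carrier R"
  by (auto simp: FactRing_def A_RCOSETS_def')

lemma (in ideal) quot_zero_iff: "p \<in> carrier R \<Longrightarrow> I +> p = \<zero>\<^bsub>R Quot I\<^esub> \<longleftrightarrow> p \<in> I"
  using rcos_const_imp_mem a_rcos_zero[OF is_ideal] by (auto simp: FactRing_def)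

lemma (in ideal) regular_element_quot:
  assumes "a \<in> carrier R"
  shows "regular_element (R Quot I) (I +> a) \<longleftrightarrow> (\<forall>y\<in>carrier R. a \<otimes> y \<in> I \<longrightarrow> y \<in> I)"
proof -
  have "(I +> a) \<otimes>\<^bsub>R Quot I\<^esub> (I +> y) = I +> (a \<otimes> y)" if "y \<in> carrier R" for y
    using rcos_ring_hom assms that by (simp add: ring_hom_mult)
  then show ?thesis
    using assms by (auto simp: regular_element_def quot_carrier quot_zero_iff)
qed

lemma (in ideal) quot_genideal_iff:
  assumes Y: "Y \<subseteq> carrier R" and p: "p \<in> carrier R"
  shows "I +> p \<in> genideal (R Quot I) ((+>) I ` Y) \<longleftrightarrow> p \<in> genideal R (I \<union> Y)"
proof -
  interpret h: ring_hom_ring R "R Quot I" "(+>) I" by (rule rcos_ring_hom_ring)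
  have IY: "I \<union> Y \<subseteq> carrier R" using Y a_subset by auto
  have Y': "(+>) I ` Y \<subseteq> carrier (R Quot I)" using Y h.hom_closed by auto
  note G = genideal_ideal[OF IY]
  note G' = h.S.genideal_ideal[OF Y']
  show ?thesis
  proof
    assume l: "I +> p \<in> genideal (R Quot I) ((+>) I ` Y)"
    have "ideal ((+>) I ` genideal R (I \<union> Y)) (R Quot I)"
      by (rule ring_ideal_imp_quot_ideal[OF is_ideal G])
    moreover have "(+>) I ` Y \<subseteq> (+>) I ` genideal R (I \<union> Y)"
      using genideal_self[OF IY] by auto
    ultimately have "I +> p \<in> (+>) I ` genideal R (I \<union> Y)"
      using l h.S.genideal_minimal by blast
    then obtain q where q: "q \<in> genideal R (I \<union> Y)" "I +> p = I +> q" by auto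
    have qc: "q \<in> carrier R" using q(1) ideal.Icarr[OF G] by auto
    have "p \<ominus> q \<in> I"
      using quotient_eq_iff_same_a_r_cos[OF is_ideal p qc] q(2) by simp
    then have "p \<ominus> q \<in> genideal R (I \<union> Y)" using genideal_self[OF IY] by auto
    then have "(p \<ominus> q) \<oplus> q \<in> genideal R (I \<union> Y)"
      using q(1) additive_subgroup.a_closed[OF ideal.axioms(1)[OF G]] by blast
    then show "p \<in> genideal R (I \<union> Y)"
      using p qc by (simp add: minus_eq a_assoc l_neg)
  next
    assume r: "p \<in> genideal R (I \<union> Y)"
    let ?K = "{r \<in> carrier R. I +> r \<in> genideal (R Quot I) ((+>) I ` Y)}"
    have "ideal ?K R" by (rule h.ideal_vimage[OF G'])
    moreover have "I \<union> Y \<subseteq> ?K"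
    proof
      fix r assume "r \<in> I \<union> Y"
      then show "r \<in> ?K"
      proof
        assume "r \<in> I"
        then have "I +> r = \<zero>\<^bsub>R Quot I\<^esub>" using quot_zero_iff a_subset by auto
        then show "r \<in> ?K"
          using \<open>r \<in> I\<close> a_subset additive_subgroup.zero_closed[OF ideal.axioms(1)[OF G']] by auto
      next
        assume "r \<in> Y"
        then show "r \<in> ?K" using Y h.S.genideal_self[OF Y'] by auto
      qed
    qed
    ultimately have "genideal R (I \<union> Y) \<subseteq> ?K" by (rule genideal_minimal)
    then show "I +> p \<in> genideal (R Quot I) ((+>) I ` Y)" using r by auto
  qed
qed

lemma (in ring) genideal_genideal_Un:
  assumes "A \<subseteq> carrier R" "B \<subseteq> carrier R"
  shows "genideal R (genideal R A \<union> B) = genideal R (A \<union> B)"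
proof
  have AB: "A \<union> B \<subseteq> carrier R" using assms by auto
  have A: "genideal R A \<subseteq> carrier R" using ideal.Icarr[OF genideal_ideal[OF assms(1)]] by auto
  have 1: "A \<union> B \<subseteq> genideal R (A \<union> B)" by (rule genideal_self[OF AB])
  have "genideal R A \<subseteq> genideal R (A \<union> B)"
    using 1 by (intro genideal_minimal genideal_ideal AB) auto
  then show "genideal R (genideal R A \<union> B) \<subseteq> genideal R (A \<union> B)"
    using 1 by (intro genideal_minimal genideal_ideal AB) auto
  have "genideal R A \<union> B \<subseteq> genideal R (genideal R A \<union> B)"
    using A assms by (intro genideal_self) auto
  moreover have "A \<subseteq> genideal R A" by (rule genideal_self[OF assms(1)])
  ultimately show "genideal R (A \<union> B) \<subseteq> genideal R (genideal R A \<union> B)"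
    using A assms by (intro genideal_minimal genideal_ideal) auto
qed

context subring_carrier
begin

lemma regular_seq_on_iff:
  assumes "ideal J R" "set fs \<subseteq> S"
  shows "regular_seq_on J fs \<longleftrightarrow>
    (\<forall>i<length fs. regular_on (genideal R (J \<union> set (take i fs))) (fs ! i))"
  using assms
proof (induction fs arbitrary: J)
  case (Cons f fs)
  have f: "f \<in> S" and fs: "set fs \<subseteq> S" using Cons.prems by auto
  have J: "J \<subseteq> S" using ideal_subset[OF Cons.prems(1)] by auto
  have "genideal R J = J"
    using J ring_R.genideal_self[of J] ring_R.genideal_minimal[OF Cons.prems(1)] by auto
  moreover have "genideal R (adjoin J f \<union> set (take i fs)) = genideal R (J \<union> set (take (Suc i) (f # fs)))" for i
  proof -
    have "genideal R (adjoin J f \<union> set (take i fs)) = genideal R (insert f J \<union> set (take i fs))"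
      unfolding adjoin_eq_genideal[OF Cons.prems(1) f]
      using f fs J set_take_subset[of i fs] by (intro ring_R.genideal_genideal_Un) auto
    then show ?thesis by simp
  qed
  ultimately show ?case
    using Cons.IH[OF ideal_adjoin[OF Cons.prems(1) f] fs]
    by (simp add: All_less_Suc2)
qed simp

text \<open>
  Lifting to \<open>S\<close> removes the iterated quotients from the notion of a regular sequence on \<open>S / I\<close>.
\<close>

lemma regular_sequence_quot_iff:
  assumes I: "ideal I R" and fs: "set fs \<subseteq> S"
  shows "regular_sequence (R Quot I) (map ((+>\<^bsub>R\<^esub>) I) fs) \<longleftrightarrow>
    regular_seq_on I fs \<and> genideal R (I \<union> set fs) \<noteq> S"
proof -
  interpret I: ideal I R by (rule I)
  interpret h: ring_hom_ring R "R Quot I" "(+>\<^bsub>R\<^esub>) I" by (rule I.rcos_ring_hom_ring)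
  let ?\<pi> = "(+>\<^bsub>R\<^esub>) I"
  have gen: "ideal (genideal (R Quot I) (?\<pi> ` Y)) (R Quot I)" if "Y \<subseteq> S" for Y
    using that h.hom_closed by (intro h.S.genideal_ideal) auto
  have 1: "regular_element (R Quot I Quot genideal (R Quot I) (set (take i (map ?\<pi> fs))))
        (genideal (R Quot I) (set (take i (map ?\<pi> fs))) +>\<^bsub>R Quot I\<^esub> (map ?\<pi> fs ! i)) \<longleftrightarrow>
      regular_on (genideal R (I \<union> set (take i fs))) (fs ! i)" if i: "i < length fs" for i
  proof -
    let ?Y = "set (take i fs)"
    have Y: "?Y \<subseteq> S" using fs set_take_subset[of i fs] by auto
    have fi: "fs ! i \<in> S" using fs i by auto
    have "?\<pi> (fs ! i) \<otimes>\<^bsub>R Quot I\<^esub> ?\<pi> y = ?\<pi> (fs ! i * y)" if "y \<in> S" for y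
      using h.hom_mult[of "fs ! i" y] fi that by simp
    then show ?thesis
      using i fi Y mult_mem
      by (simp add: take_map ideal.regular_element_quot[OF gen[OF Y]] I.quot_carrier
          regular_on_def I.quot_genideal_iff)
  qed
  have "genideal (R Quot I) (?\<pi> ` set fs) = carrier (R Quot I) \<longleftrightarrow> genideal R (I \<union> set fs) = S"
  proof -
    have "genideal (R Quot I) (?\<pi> ` set fs) \<subseteq> carrier (R Quot I)"
      using ideal.Icarr[OF gen[OF fs]] by auto
    moreover have "genideal R (I \<union> set fs) \<subseteq> S"
      using ideal.Icarr[OF ring_R.genideal_ideal[of "I \<union> set fs"]] fs I.a_subset by auto
    moreover have "carrier (R Quot I) \<subseteq> genideal (R Quot I) (?\<pi> ` set fs) \<longleftrightarrow> S \<subseteq> genideal R (I \<union> set fs)"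
      using fs by (auto simp: I.quot_carrier I.quot_genideal_iff)
    ultimately show ?thesis by auto
  qed
  moreover have "set (map ?\<pi> fs) \<subseteq> carrier (R Quot I)"
    using fs h.hom_closed by auto
  ultimately show ?thesis
    unfolding regular_sequence_def Let_def regular_seq_on_iff[OF I fs]
    using 1 by simp
qed

end

section \<open>Ideals of a quotient ring\<close>

context subring_carrier
begin

context
  fixes I assumes I: "ideal I R"
begin

interpretation I: ideal I R by (rule I)
interpretation h: ring_hom_ring R "R Quot I" "(+>\<^bsub>R\<^esub>) I" by (rule I.rcos_ring_hom_ring)

lemma quot_image_iff:
  assumes K: "ideal K R" "I \<subseteq> K" and p: "p \<in> S"
  shows "I +>\<^bsub>R\<^esub> p \<in> (+>\<^bsub>R\<^esub>) I ` K \<longleftrightarrow> p \<in> K"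
proof
  assume "I +>\<^bsub>R\<^esub> p \<in> (+>\<^bsub>R\<^esub>) I ` K"
  then obtain q where q: "q \<in> K" "I +>\<^bsub>R\<^esub> p = I +>\<^bsub>R\<^esub> q" by auto
  have qS: "q \<in> S" using ideal_subset[OF K(1)] q(1) .
  have "p \<ominus>\<^bsub>R\<^esub> q \<in> I"
    using ring_R.quotient_eq_iff_same_a_r_cos[OF I, of p q] p qS q(2) by simp
  then have "(p \<ominus>\<^bsub>R\<^esub> q) + q \<in> K"
    using ideal_add[OF K(1)] q(1) K(2) by blast
  moreover have "(p \<ominus>\<^bsub>R\<^esub> q) + q = p"
    using ring_R.minus_eq[of p q] ring_R.a_assoc[of p "\<ominus>\<^bsub>R\<^esub> q" q] ring_R.l_neg[of q] p qS
      ring_R.a_inv_closed[of q] by simp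
  ultimately show "p \<in> K" by simp
qed auto

text \<open>
  Ideals between \<open>I\<close> and \<open>S\<close> correspond to ideals of the quotient, and there chains of ideals have a
  largest element.
\<close>

lemma maximum_condition_of_noetherian:
  assumes "noetherian_ring (R Quot I)"
  shows "ideal_maximum_condition I"
  unfolding ideal_maximum_condition_def
proof (intro allI impI, elim conjE)
  fix \<K> assume ne: "\<K> \<noteq> {}" and \<K>: "\<forall>K\<in>\<K>. ideal K R \<and> I \<subseteq> K"
  let ?\<pi> = "(+>\<^bsub>R\<^esub>) I"
  have "\<exists>M\<in>(`) ?\<pi> ` \<K>. \<forall>L\<in>(`) ?\<pi> ` \<K>. M \<subseteq> L \<longrightarrow> L = M"
  proof (rule subset_Zorn_nonempty)
    show "(`) ?\<pi> ` \<K> \<noteq> {}" using ne by auto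
    fix \<C> assume \<C>: "\<C> \<noteq> {}" "subset.chain ((`) ?\<pi> ` \<K>) \<C>"
    have sub: "(`) ?\<pi> ` \<K> \<subseteq> {L. ideal L (R Quot I)}"
      using \<K> ring_R.ring_ideal_imp_quot_ideal[OF I] by auto
    then have "subset.chain {L. ideal L (R Quot I)} \<C>"
      using \<C>(2) order_trans[OF _ sub] by (simp add: subset.chain_def)
    then have "\<Union>\<C> \<in> \<C>"
      by (rule noetherian_ring.ideal_chain_is_trivial[OF assms \<C>(1)])
    then show "\<Union>\<C> \<in> (`) ?\<pi> ` \<K>" using \<C>(2) by (auto simp: subset.chain_def)
  qed
  then obtain M where M: "M \<in> \<K>" "\<And>L. L \<in> \<K> \<Longrightarrow> ?\<pi> ` M \<subseteq> ?\<pi> ` L \<Longrightarrow> ?\<pi> ` L = ?\<pi> ` M"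
    by auto
  show "\<exists>M\<in>\<K>. \<forall>K\<in>\<K>. M \<subseteq> K \<longrightarrow> K = M"
  proof (intro bexI[OF _ M(1)] ballI impI)
    fix K assume K: "K \<in> \<K>" "M \<subseteq> K"
    then have eq: "?\<pi> ` K = ?\<pi> ` M" using M(2)[OF K(1) image_mono] by simp
    have "K \<subseteq> M"
    proof
      fix p assume p: "p \<in> K"
      then have "?\<pi> p \<in> ?\<pi> ` M" using eq by auto
      moreover have "p \<in> S" using p K(1) \<K> ideal_subset by blast
      ultimately show "p \<in> M" using quot_image_iff[of M p] M(1) \<K> by auto
    qed
    then show "K = M" using K by auto
  qed
qed

lemma primeideal_quot_image:
  assumes P: "primeideal P R" and IP: "I \<subseteq> P"
  shows "primeideal ((+>\<^bsub>R\<^esub>) I ` P) (R Quot I)"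
proof (rule primeidealI)
  let ?\<pi> = "(+>\<^bsub>R\<^esub>) I"
  have Pi: "ideal P R" using P by (simp add: primeideal_iff)
  show "ideal (?\<pi> ` P) (R Quot I)" by (rule ring_R.ring_ideal_imp_quot_ideal[OF I Pi])
  show "cring (R Quot I)" by (rule I.quotient_is_cring[OF cring_R])
  have "1 \<notin> P" using P by (simp add: primeideal_iff)
  then have "?\<pi> 1 \<notin> ?\<pi> ` P" using quot_image_iff[OF Pi IP] one_mem by auto
  moreover have "?\<pi> 1 \<in> carrier (R Quot I)" using one_mem by (auto simp: I.quot_carrier)
  ultimately show "carrier (R Quot I) \<noteq> ?\<pi> ` P" by auto
  fix a b assume "a \<in> carrier (R Quot I)" "b \<in> carrier (R Quot I)" and ab: "a \<otimes>\<^bsub>R Quot I\<^esub> b \<in> ?\<pi> ` P"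
  then obtain p q where p: "p \<in> S" "a = ?\<pi> p" and q: "q \<in> S" "b = ?\<pi> q"
    by (auto simp: I.quot_carrier)
  have "?\<pi> (p * q) \<in> ?\<pi> ` P" using ab h.hom_mult[of p q] p q by simp
  then have "p * q \<in> P" using quot_image_iff[OF Pi IP] mult_mem[OF p(1) q(1)] by simp
  then show "a \<in> ?\<pi> ` P \<or> b \<in> ?\<pi> ` P" using P p q by (auto simp: primeideal_iff)
qed

lemma maximalideal_quot_image:
  assumes M: "ideal M R" "1 \<notin> M" and IM: "I \<subseteq> M"
    and max: "\<And>K. ideal K R \<Longrightarrow> M \<subseteq> K \<Longrightarrow> K = M \<or> 1 \<in> K"
  shows "maximalideal ((+>\<^bsub>R\<^esub>) I ` M) (R Quot I)"
proof (rule maximalidealI)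
  let ?\<pi> = "(+>\<^bsub>R\<^esub>) I"
  show "ideal (?\<pi> ` M) (R Quot I)" by (rule ring_R.ring_ideal_imp_quot_ideal[OF I M(1)])
  have "?\<pi> 1 \<notin> ?\<pi> ` M" using quot_image_iff[OF M(1) IM] one_mem M(2) by auto
  moreover have "?\<pi> 1 \<in> carrier (R Quot I)" using one_mem by (auto simp: I.quot_carrier)
  ultimately show "carrier (R Quot I) \<noteq> ?\<pi> ` M" by auto
  fix J assume J: "ideal J (R Quot I)" "?\<pi> ` M \<subseteq> J" "J \<subseteq> carrier (R Quot I)"
  define K where "K = {r \<in> carrier R. ?\<pi> r \<in> J}"
  have K: "ideal K R" unfolding K_def by (rule h.ideal_vimage[OF J(1)])
  have MK: "M \<subseteq> K" using J(2) ideal_subset[OF M(1)] by (auto simp: K_def)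
  have JK: "J = ?\<pi> ` K" using J(3) by (auto simp: K_def I.quot_carrier)
  show "J = ?\<pi> ` M \<or> J = carrier (R Quot I)"
  proof (cases "K = M")
    case False
    then have "1 \<in> K" using max[OF K MK] by auto
    then have "K = S" using ideal_mult[OF K, of 1] ideal_subset[OF K] by auto
    then show ?thesis by (simp add: JK I.quot_carrier)
  qed (simp add: JK)
qed

end

end

text \<open>
  The maximum condition passes to a retract, because taking preimages under \<open>\<rho>\<close> embeds the ideals of the
  image into the ideals of \<open>S\<close>. This yields the Noetherian property of the edge ring of \<open>G \<setminus> u\<close> from
  that of \<open>G\<close>.
\<close>

lemma (in koszul_retract) maximum_condition_retract:
  assumes I: "ideal I R" and \<rho>I: "\<And>s. s \<in> I \<Longrightarrow> \<rho> s \<in> I"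
    and S': "S' = {s \<in> S. \<rho> s = s}" "subring_carrier S'" and I': "I' = I \<inter> S'"
    and max: "ideal_maximum_condition I"
  shows "subring_carrier.ideal_maximum_condition S' I'"
proof -
  interpret S': subring_carrier S' by (rule S')
  have \<rho>S': "\<rho> s \<in> S'" if "s \<in> S" for s using that \<rho>_mem \<rho>_idem by (simp add: S')
  show ?thesis
    unfolding S'.ideal_maximum_condition_def
  proof (intro allI impI, elim conjE)
    fix \<K> assume ne: "\<K> \<noteq> {}" and \<K>: "\<forall>K\<in>\<K>. ideal K S'.R \<and> I' \<subseteq> K"
    define pre where "pre K = {s \<in> S. \<rho> s \<in> K}" for K
    have pre: "ideal (pre K) R \<and> I \<subseteq> pre K" if "K \<in> \<K>" for K
    proof
      have K: "ideal K S'.R" "I' \<subseteq> K" using that \<K> by auto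
      show "ideal (pre K) R"
        unfolding ideal_iff pre_def
        using S'.ideal_zero[OF K(1)] S'.ideal_add[OF K(1)] S'.ideal_mult[OF K(1)] \<rho>S'
        by (auto simp: zero_mem add_mem mult_mem \<rho>_simps(1,2,4))
      show "I \<subseteq> pre K"
        using K(2) \<rho>I \<rho>S' ideal_subset[OF I] by (auto simp: pre_def I')
    qed
    have "pre ` \<K> \<noteq> {} \<and> (\<forall>K\<in>pre ` \<K>. ideal K R \<and> I \<subseteq> K)"
      using ne pre by auto
    from max[unfolded ideal_maximum_condition_def, rule_format, OF this]
    obtain M where M: "M \<in> \<K>" "\<forall>K\<in>\<K>. pre M \<subseteq> pre K \<longrightarrow> pre K = pre M" by auto
    show "\<exists>M\<in>\<K>. \<forall>K\<in>\<K>. M \<subseteq> K \<longrightarrow> K = M"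
    proof (intro bexI[OF _ M(1)] ballI impI)
      fix K assume K: "K \<in> \<K>" "M \<subseteq> K"
      then have "pre K = pre M" using M(2) by (auto simp: pre_def)
      moreover have "L = pre L \<inter> S'" if "L \<in> \<K>" for L
        using \<K> that S'.ideal_subset[of L] by (auto simp: pre_def S')
      ultimately show "K = M" using K(1) M(1) by metis
    qed
  qed
qed

section \<open>Polynomials: setting variables to zero\<close>

lemma keys_add_nat:
  fixes m m' :: "'v \<Rightarrow>\<^sub>0 nat"
  shows "Poly_Mapping.keys (m + m') = Poly_Mapping.keys m \<union> Poly_Mapping.keys m'"
  by (auto simp: in_keys_iff lookup_add)

lemma poly_mapping_eq_sum_singles:
  fixes p :: "'m \<Rightarrow>\<^sub>0 'k::comm_monoid_add"
  shows "p = (\<Sum>m\<in>Poly_Mapping.keys p. Poly_Mapping.single m (Poly_Mapping.lookup p m))"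
proof (rule poly_mapping_eqI)
  fix k
  have "(\<Sum>m\<in>Poly_Mapping.keys p. Poly_Mapping.lookup p m when m = k) = Poly_Mapping.lookup p k"
  proof (cases "k \<in> Poly_Mapping.keys p")
    case True
    then show ?thesis by (simp add: when_def)
  next
    case False
    then show ?thesis by (simp add: when_def in_keys_iff)
  qed
  then show "Poly_Mapping.lookup p k = Poly_Mapping.lookup
      (\<Sum>m\<in>Poly_Mapping.keys p. Poly_Mapping.single m (Poly_Mapping.lookup p m)) k"
    by (simp add: lookup_sum lookup_single)
qed

lemma poly_mapping_additive_induct [case_names zero single add]:
  fixes p :: "'m \<Rightarrow>\<^sub>0 'k::comm_monoid_add"
  assumes "P 0" and "\<And>m c. m \<in> Poly_Mapping.keys p \<Longrightarrow> P (Poly_Mapping.single m c)"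
    and "\<And>p q. P p \<Longrightarrow> P q \<Longrightarrow> P (p + q)"
  shows "P p"
proof -
  have "P (\<Sum>m\<in>A. Poly_Mapping.single m (Poly_Mapping.lookup p m))"
    if "finite A" "A \<subseteq> Poly_Mapping.keys p" for A
    using that by (induction A rule: finite_induct) (auto intro: assms)
  from this[of "Poly_Mapping.keys p"] show ?thesis
    using poly_mapping_eq_sum_singles[of p] by simp
qed

text \<open>
  The substitution of 0 for all variables in \<open>W\<close>; on coefficients it selects the monomials that
  avoid \<open>W\<close>.
\<close>

definition kill_vars :: "'v set \<Rightarrow> ('v, 'k::field) mvpoly \<Rightarrow> ('v, 'k) mvpoly" where
  "kill_vars W p = Abs_poly_mapping
     (\<lambda>m. Poly_Mapping.lookup p m when Poly_Mapping.keys m \<inter> W = {})"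

lemma lookup_kill_vars:
  "Poly_Mapping.lookup (kill_vars W p) m =
    (Poly_Mapping.lookup p m when Poly_Mapping.keys m \<inter> W = {})"
proof -
  have "finite {m. (Poly_Mapping.lookup p m when Poly_Mapping.keys m \<inter> W = {}) \<noteq> 0}"
    by (rule finite_subset[OF _ finite_keys[of p]]) (auto simp: in_keys_iff)
  then show ?thesis by (simp add: kill_vars_def)
qed

lemma kill_vars_add: "kill_vars W (p + q) = kill_vars W p + kill_vars W q"
  by (rule poly_mapping_eqI) (simp add: lookup_kill_vars lookup_add when_add_distrib)

lemma kill_vars_zero: "kill_vars W 0 = 0"
  by (rule poly_mapping_eqI) (simp add: lookup_kill_vars)

lemma kill_vars_single:
  "kill_vars W (Poly_Mapping.single m c) =
    (if Poly_Mapping.keys m \<inter> W = {} then Poly_Mapping.single m c else 0)"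
  by (rule poly_mapping_eqI) (auto simp: lookup_kill_vars lookup_single when_def)

lemma kill_vars_mult: "kill_vars W (p * q) = kill_vars W p * kill_vars W q"
proof (induction p rule: poly_mapping_additive_induct)
  case (single m c)
  show ?case
  proof (induction q rule: poly_mapping_additive_induct)
    case (single m' c')
    show ?case
      by (auto simp: mult_single kill_vars_single keys_add_nat Int_Un_distrib2)
  qed (simp_all add: kill_vars_zero kill_vars_add distrib_left)
qed (simp_all add: kill_vars_zero kill_vars_add distrib_right)

lemma ring_endo_kill_vars: "ring_endo (kill_vars W)"
  unfolding ring_endo_def
  by (auto simp: kill_vars_add kill_vars_mult kill_vars_single simp flip: single_one)

lemma kill_vars_variable: "kill_vars W (variable v) = (if v \<in> W then 0 else variable v)"
  by (auto simp: variable_def kill_vars_single)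

lemma kill_vars_kill_vars: "kill_vars W (kill_vars W' p) = kill_vars (W \<union> W') p"
  by (rule poly_mapping_eqI) (auto simp: lookup_kill_vars when_def)

lemma variable_nonzero: "variable v \<noteq> 0"
  by (simp add: variable_def) (metis lookup_single_eq lookup_zero zero_neq_one)

definition poly_carrier :: "'v set \<Rightarrow> ('v, 'k::field) mvpoly set" where
  "poly_carrier V = {p. \<forall>m\<in>Poly_Mapping.keys p. Poly_Mapping.keys m \<subseteq> V}"

lemma polynomial_ring_eq: "polynomial_ring V = ring_on (poly_carrier V)"
  by (simp add: polynomial_ring_def ring_on_def poly_carrier_def)

lemma poly_carrier_iff: "p \<in> poly_carrier V \<longleftrightarrow> kill_vars (- V) p = p"
  by (auto simp: poly_carrier_def poly_mapping_eq_iff fun_eq_iff lookup_kill_vars when_def in_keys_iff)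

lemma subring_poly_carrier: "subring_carrier (poly_carrier V)"
  by unfold_locales
    (simp_all add: poly_carrier_iff ring_endo_simps[OF ring_endo_kill_vars])

lemma variable_mem: "v \<in> V \<Longrightarrow> variable v \<in> poly_carrier V"
  by (simp add: poly_carrier_iff kill_vars_variable)

lemma single_mem: "Poly_Mapping.keys m \<subseteq> V \<Longrightarrow> Poly_Mapping.single m c \<in> poly_carrier V"
  by (auto simp: poly_carrier_iff kill_vars_single)

lemma kill_vars_mem: "p \<in> poly_carrier V \<Longrightarrow> kill_vars W p \<in> poly_carrier V"
  by (simp add: poly_carrier_iff kill_vars_kill_vars Un_commute)
     (metis kill_vars_kill_vars Un_commute)

lemma poly_carrier_Diff: "poly_carrier (V - W) = {p \<in> poly_carrier V. kill_vars W p = p}"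
  unfolding poly_carrier_def
  by (auto simp: poly_mapping_eq_iff fun_eq_iff lookup_kill_vars when_def in_keys_iff)

text \<open>
  Kronecker substitution: sending the variable \<open>v\<close> to the power \<open>c v\<close> of one indeterminate separates
  finitely many monomials if the exponents grow fast enough.
\<close>

lemma separating_weight:
  fixes K :: "('v \<Rightarrow>\<^sub>0 nat) set"
  assumes "finite V" "finite K"
  shows "\<exists>c :: 'v \<Rightarrow> nat. \<forall>m\<in>K. \<forall>m'\<in>K.
    (\<Sum>v\<in>V. c v * Poly_Mapping.lookup m v) = (\<Sum>v\<in>V. c v * Poly_Mapping.lookup m' v) \<longrightarrow>
    (\<forall>v\<in>V. Poly_Mapping.lookup m v = Poly_Mapping.lookup m' v)"
  using assms(1)
proof (induction V rule: finite_induct)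
  case (insert u V)
  then obtain c :: "'v \<Rightarrow> nat" where c: "\<And>m m'. m \<in> K \<Longrightarrow> m' \<in> K \<Longrightarrow>
      (\<Sum>v\<in>V. c v * Poly_Mapping.lookup m v) = (\<Sum>v\<in>V. c v * Poly_Mapping.lookup m' v) \<Longrightarrow>
      \<forall>v\<in>V. Poly_Mapping.lookup m v = Poly_Mapping.lookup m' v" by metis
  define w where "w m = (\<Sum>v\<in>V. c v * Poly_Mapping.lookup m v)" for m
  obtain M where M: "\<And>m. m \<in> K \<Longrightarrow> w m < M"
    using finite_nat_set_iff_bounded[of "w ` K"] assms(2) by auto
  show ?case
  proof (intro exI[of _ "c(u := M)"] ballI impI)
    fix m m' v
    assume m: "m \<in> K" "m' \<in> K" and v: "v \<in> insert u V"
      and eq: "(\<Sum>v\<in>insert u V. (c(u := M)) v * Poly_Mapping.lookup m v) =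
        (\<Sum>v\<in>insert u V. (c(u := M)) v * Poly_Mapping.lookup m' v)"
    have sum: "(\<Sum>v\<in>insert u V. (c(u := M)) v * Poly_Mapping.lookup m v) =
        M * Poly_Mapping.lookup m u + w m" for m
    proof -
      have "(\<Sum>v\<in>V. (c(u := M)) v * Poly_Mapping.lookup m v) = w m"
        unfolding w_def using insert.hyps by (intro sum.cong) auto
      then show ?thesis using insert.hyps by simp
    qed
    have e: "M * Poly_Mapping.lookup m u + w m = M * Poly_Mapping.lookup m' u + w m'"
      using eq unfolding sum .
    from arg_cong[OF e, of "\<lambda>t. t mod M"] have "w m = w m'"
      using M m by simp
    moreover from this have "Poly_Mapping.lookup m u = Poly_Mapping.lookup m' u"
      using e M[OF m(1)] by auto
    ultimately show "Poly_Mapping.lookup m v = Poly_Mapping.lookup m' v"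
      using c[OF m] v by (auto simp: w_def)
  qed
qed simp

lemma poly_mapping_mult_eq_sum:
  fixes p q :: "('v, 'k::field) mvpoly"
  shows "Poly_Mapping.lookup (p * q) k =
    (\<Sum>l\<in>Poly_Mapping.keys p. \<Sum>r\<in>Poly_Mapping.keys q.
      Poly_Mapping.lookup p l * Poly_Mapping.lookup q r when l + r = k)"
proof -
  have "p * q = (\<Sum>l\<in>Poly_Mapping.keys p. Poly_Mapping.single l (Poly_Mapping.lookup p l)) *
      (\<Sum>r\<in>Poly_Mapping.keys q. Poly_Mapping.single r (Poly_Mapping.lookup q r))"
    by (simp flip: poly_mapping_eq_sum_singles)
  then show ?thesis
    by (simp add: sum_product mult_single lookup_sum lookup_single)
qed

text \<open>
  For a weight that separates the monomials of \<open>p\<close> and \<open>q\<close>, the product of the two monomials of largest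
  weight occurs only once in the expansion of \<open>p * q\<close>. A weight is used as there is no order
  on the variables.
\<close>

lemma mvpoly_no_zero_divisors:
  fixes p q :: "('v, 'k::field) mvpoly"
  assumes "p \<noteq> 0" "q \<noteq> 0"
  shows "p * q \<noteq> 0"
proof -
  let ?K = "Poly_Mapping.keys p \<union> Poly_Mapping.keys q"
  let ?V = "\<Union>m\<in>?K. Poly_Mapping.keys m"
  have "finite ?V" "finite ?K" by auto
  from separating_weight[OF this] obtain c :: "'v \<Rightarrow> nat" where c: "\<forall>m\<in>?K. \<forall>m'\<in>?K.
      (\<Sum>v\<in>?V. c v * Poly_Mapping.lookup m v) = (\<Sum>v\<in>?V. c v * Poly_Mapping.lookup m' v) \<longrightarrow>
      (\<forall>v\<in>?V. Poly_Mapping.lookup m v = Poly_Mapping.lookup m' v)"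
    by (elim exE)
  define w where "w m = (\<Sum>v\<in>?V. c v * Poly_Mapping.lookup m v)" for m
  have w_add: "w (m + m') = w m + w m'" for m m'
    by (simp add: w_def lookup_add distrib_left sum.distrib)
  have w_inj: "m = m'" if "m \<in> ?K" "m' \<in> ?K" "w m = w m'" for m m'
  proof (rule poly_mapping_eqI)
    fix v
    show "Poly_Mapping.lookup m v = Poly_Mapping.lookup m' v"
    proof (cases "v \<in> ?V")
      case True
      then show ?thesis
        using c[THEN bspec, OF that(1), THEN bspec, OF that(2)] that(3) unfolding w_def by blast
    next
      case False
      then show ?thesis using that(1,2) by (auto simp: in_keys_iff)
    qed
  qed
  have top: "\<exists>m\<in>Poly_Mapping.keys r. \<forall>m'\<in>Poly_Mapping.keys r. w m' \<le> w m"
    if "r \<noteq> 0" for r :: "('v, 'k) mvpoly"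
  proof -
    have "finite (w ` Poly_Mapping.keys r)" "w ` Poly_Mapping.keys r \<noteq> {}"
      using that by (auto simp: poly_mapping_eq_iff fun_eq_iff in_keys_iff)
    then have "Max (w ` Poly_Mapping.keys r) \<in> w ` Poly_Mapping.keys r" by (rule Max_in)
    then show ?thesis
      by (metis (no_types, lifting) Max_ge \<open>finite (w ` Poly_Mapping.keys r)\<close> imageE imageI)
  qed
  obtain m where m: "m \<in> Poly_Mapping.keys p" "\<And>l. l \<in> Poly_Mapping.keys p \<Longrightarrow> w l \<le> w m"
    using top[OF assms(1)] by auto
  obtain m' where m': "m' \<in> Poly_Mapping.keys q" "\<And>l. l \<in> Poly_Mapping.keys q \<Longrightarrow> w l \<le> w m'"
    using top[OF assms(2)] by auto
  have eq: "l + r = m + m' \<longleftrightarrow> l = m \<and> r = m'"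
    if "l \<in> Poly_Mapping.keys p" "r \<in> Poly_Mapping.keys q" for l r
  proof
    assume "l + r = m + m'"
    then have "w l + w r = w m + w m'" by (simp flip: w_add)
    then have "w l = w m" "w r = w m'" using m(2)[OF that(1)] m'(2)[OF that(2)] by auto
    then show "l = m \<and> r = m'" using w_inj that m(1) m'(1) by auto
  qed simp
  have "Poly_Mapping.lookup (p * q) (m + m') =
      (\<Sum>l\<in>Poly_Mapping.keys p. \<Sum>r\<in>Poly_Mapping.keys q.
        if l = m then (if r = m' then Poly_Mapping.lookup p l * Poly_Mapping.lookup q r else 0) else 0)"
    unfolding poly_mapping_mult_eq_sum by (intro sum.cong refl) (simp add: eq when_def)
  also have "\<dots> = (\<Sum>l\<in>Poly_Mapping.keys p. if l = m then
      (\<Sum>r\<in>Poly_Mapping.keys q. if r = m' then Poly_Mapping.lookup p l * Poly_Mapping.lookup q r else 0) else 0)"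
    by (intro sum.cong refl) simp
  also have "\<dots> = Poly_Mapping.lookup p m * Poly_Mapping.lookup q m'"
    using m(1) m'(1) by simp
  finally show ?thesis
    using m(1) m'(1) by (auto simp: in_keys_iff)
qed

lemma prod_variable_nonzero: "(\<Prod>v\<in>T. variable v) \<noteq> (0 :: ('v, 'k::field) mvpoly)"
  by (induction T rule: infinite_finite_induct)
    (simp_all add: mvpoly_no_zero_divisors variable_nonzero)

lemma kill_vars_congruent:
  fixes s :: "('v, 'k::field) mvpoly"
  assumes "s \<in> poly_carrier V"
  shows "\<exists>t\<in>poly_carrier V. s = kill_vars {u} s + variable u * t"
proof -
  interpret subring_carrier "poly_carrier V :: ('v, 'k) mvpoly set" by (rule subring_poly_carrier)
  show ?thesis
  proof (induction s rule: poly_mapping_additive_induct)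
    case zero
    then show ?case by (auto simp: kill_vars_zero intro!: bexI[of _ 0] zero_mem)
  next
    case (single m c)
    have mV: "Poly_Mapping.keys m \<subseteq> V" using single assms by (auto simp: poly_carrier_def)
    show ?case
    proof (cases "u \<in> Poly_Mapping.keys m")
      case False
      then show ?thesis
        by (intro bexI[of _ 0] zero_mem) (auto simp: kill_vars_single)
    next
      case True
      define m' where "m' = m - Poly_Mapping.single u 1"
      have "Poly_Mapping.single u 1 + m' = m"
        using True by (intro poly_mapping_eqI)
          (auto simp: m'_def lookup_add lookup_minus lookup_single in_keys_iff when_def)
      moreover have "Poly_Mapping.keys m' \<subseteq> Poly_Mapping.keys m"
        by (auto simp: m'_def in_keys_iff lookup_minus)
      ultimately show ?thesis
        using True mV
        by (intro bexI[of _ "Poly_Mapping.single m' c"] single_mem)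
          (auto simp: kill_vars_single variable_def mult_single)
    qed
  next
    case (add p q)
    then obtain t t' where "t \<in> poly_carrier V" "p = kill_vars {u} p + variable u * t"
      "t' \<in> poly_carrier V" "q = kill_vars {u} q + variable u * t'" by auto
    then have "p + q = (kill_vars {u} p + variable u * t) + (kill_vars {u} q + variable u * t')"
      by (intro arg_cong2[where f = "(+)"])
    also have "\<dots> = kill_vars {u} (p + q) + variable u * (t + t')"
      by (simp add: kill_vars_add distrib_left)
    finally show ?case
      using \<open>t \<in> poly_carrier V\<close> \<open>t' \<in> poly_carrier V\<close> add_mem by blast
  qed
qed

lemma kill_vars_all:
  fixes s :: "('v, 'k::field) mvpoly"
  assumes "s \<in> poly_carrier V"
  shows "kill_vars V s = Poly_Mapping.single 0 (Poly_Mapping.lookup s 0)"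
proof (rule poly_mapping_eqI)
  fix m :: "'v \<Rightarrow>\<^sub>0 nat"
  have "m = 0 \<longleftrightarrow> Poly_Mapping.keys m = {}"
    by (simp add: poly_mapping_eq_iff fun_eq_iff set_eq_iff in_keys_iff)
  moreover have "Poly_Mapping.lookup s m = 0" if "\<not> Poly_Mapping.keys m \<subseteq> V"
    using assms that by (auto simp: poly_carrier_def in_keys_iff)
  moreover have "Poly_Mapping.keys m \<inter> V = {} \<Longrightarrow> Poly_Mapping.keys m \<subseteq> V \<Longrightarrow> Poly_Mapping.keys m = {}"
    by (metis Int_absorb2)
  ultimately show "Poly_Mapping.lookup (kill_vars V s) m =
      Poly_Mapping.lookup (Poly_Mapping.single 0 (Poly_Mapping.lookup s 0)) m"
    by (cases "m = 0") (auto simp: lookup_kill_vars lookup_single when_def)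
qed

lemma kill_vars_prod_variable:
  assumes "A \<inter> W = {}"
  shows "kill_vars W (\<Prod>v\<in>A. variable v) = (\<Prod>v\<in>A. variable v)"
  using assms
  by (induction A rule: infinite_finite_induct)
    (simp_all add: ring_endo_simps[OF ring_endo_kill_vars] kill_vars_variable)

section \<open>Edge rings\<close>

text \<open>
  The parameter \<open>K\<close> names the coefficient field, as in \<open>edge_ring\<close>.
\<close>

locale edge_ring_of =
  fixes G :: "'v sgraph" and K :: "'k::field itself" and rank :: "'v \<Rightarrow> nat"
  assumes simple: "simple_graph G" and inj_rank: "inj_on rank (verts G)"
begin

abbreviation S :: "('v, 'k) mvpoly set" where "S \<equiv> poly_carrier (verts G)"
abbreviation I :: "('v, 'k) mvpoly set" where "I \<equiv> edge_ideal G"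

sublocale koszul_complex S "verts G" variable rank
proof (intro koszul_complex.intro subring_poly_carrier koszul_complex_axioms.intro)
  show "finite (verts G)" using simple by (simp add: simple_graph_def)
qed (use inj_rank variable_mem in auto)

lemma edge_verts: "{a, b} \<in> edges G \<Longrightarrow> a \<in> verts G \<and> b \<in> verts G"
  using simple by (auto simp: simple_graph_def)

lemma edge_ideal_eq: "I = genideal R {variable a * variable b | a b. {a, b} \<in> edges G}"
  by (simp add: edge_ideal_def polynomial_ring_eq)

lemma edge_gens_subset: "{variable a * variable b | a b. {a, b} \<in> edges G} \<subseteq> S"
  using edge_verts by (auto intro!: mult_mem variable_mem)

lemma ideal_edge_ideal: "ideal I R"
  unfolding edge_ideal_eq using edge_gens_subset by (intro ring_R.genideal_ideal) simp

lemma edge_mem: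
  assumes "{a, b} \<in> edges G"
  shows "variable a * variable b \<in> I"
proof -
  have "{variable a * variable b | a b. {a, b} \<in> edges G} \<subseteq> I"
    unfolding edge_ideal_eq using edge_gens_subset by (intro ring_R.genideal_self) simp
  then show ?thesis using assms by blast
qed

lemma edge_ideal_minimal:
  assumes "ideal J R" and "\<And>a b. {a, b} \<in> edges G \<Longrightarrow> variable a * variable b \<in> J"
  shows "I \<subseteq> J"
  unfolding edge_ideal_eq using assms by (intro ring_R.genideal_minimal) auto

lemma ideal_kill_vars_preimage:
  assumes J: "ideal J R'" and R': "R' = ring_on S'" "subring_carrier S'"
    and mem: "\<And>s. s \<in> S \<Longrightarrow> kill_vars W s \<in> S'"
  shows "ideal {s \<in> S. kill_vars W s \<in> J} R"
proof -
  interpret S': subring_carrier S' by (rule R'(2))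
  have J: "ideal J S'.R" using J R'(1) by simp
  show ?thesis
    unfolding ideal_iff
    using S'.ideal_zero[OF J] S'.ideal_add[OF J] S'.ideal_mult[OF J] mem
    by (auto simp: zero_mem add_mem mult_mem kill_vars_zero kill_vars_add kill_vars_mult)
qed

lemma kill_vars_edge_ideal:
  assumes "p \<in> I"
  shows "kill_vars W p \<in> I"
proof -
  have "I \<subseteq> {s \<in> S. kill_vars W s \<in> I}"
  proof (rule edge_ideal_minimal)
    show "ideal {s \<in> S. kill_vars W s \<in> I} R"
      by (rule ideal_kill_vars_preimage[OF ideal_edge_ideal refl])
        (auto intro: subring_poly_carrier kill_vars_mem)
    fix a b assume ab: "{a, b} \<in> edges G"
    then show "variable a * variable b \<in> {s \<in> S. kill_vars W s \<in> I}"
      using edge_verts[OF ab] edge_mem[OF ab] ideal_zero[OF ideal_edge_ideal]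
      by (simp add: mult_mem variable_mem kill_vars_mult kill_vars_variable)
  qed
  then show ?thesis using assms by auto
qed

text \<open>
  This is the ideal generated by the variables in \<open>W\<close>, described as the kernel of a homomorphism into a domain.
\<close>

lemma primeideal_kill_vars: "primeideal {p \<in> S. kill_vars W p = 0} R"
  unfolding primeideal_iff ideal_iff
  using zero_mem mvpoly_no_zero_divisors
  by (auto simp: add_mem mult_mem ring_endo_simps[OF ring_endo_kill_vars] mult.commute)

lemma ideal_kill_vars: "ideal {p \<in> S. kill_vars W p = 0} R"
  using primeideal_kill_vars primeideal_iff by blast

lemma var_ideal_iff: "p \<in> var_ideal \<longleftrightarrow> p \<in> S \<and> kill_vars (verts G) p = 0"
proof
  assume p: "p \<in> var_ideal"
  have "var_ideal \<subseteq> {p \<in> S. kill_vars (verts G) p = 0}"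
    by (rule var_ideal_minimal[OF ideal_kill_vars]) (simp add: variable_mem kill_vars_variable)
  then show "p \<in> S \<and> kill_vars (verts G) p = 0" using p by auto
next
  assume p: "p \<in> S \<and> kill_vars (verts G) p = 0"
  have "p - kill_vars (verts G) p \<in> var_ideal"
  proof (induction p rule: poly_mapping_additive_induct)
    case zero
    then show ?case using ideal_zero[OF ideal_var_ideal] by (simp add: kill_vars_zero)
  next
    case (single m c)
    then have m: "Poly_Mapping.keys m \<subseteq> verts G" using p by (auto simp: poly_carrier_def)
    show ?case
    proof (cases "Poly_Mapping.keys m = {}")
      case True
      then show ?thesis using ideal_zero[OF ideal_var_ideal] by (simp add: kill_vars_single)
    next
      case False
      then obtain u where u: "u \<in> Poly_Mapping.keys m" by blast
      obtain t where "t \<in> S" "Poly_Mapping.single m c =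
          kill_vars {u} (Poly_Mapping.single m c) + variable u * t"
        using kill_vars_congruent[OF single_mem[OF m]] by blast
      then have "Poly_Mapping.single m c \<in> var_ideal"
        using u m by (auto simp: kill_vars_single intro!: ideal_mult_right[OF ideal_var_ideal] x_in_var_ideal)
      moreover have "Poly_Mapping.keys m \<inter> verts G \<noteq> {}" using u m by auto
      ultimately show ?thesis by (simp add: kill_vars_single)
    qed
  next
    case (add p q)
    then show ?case
      using ideal_add[OF ideal_var_ideal add] by (simp add: kill_vars_add algebra_simps)
  qed
  then show "p \<in> var_ideal" using p by simp
qed

lemma one_notin_var_ideal: "1 \<notin> var_ideal"
  by (simp add: var_ideal_iff ring_endo_simps(3)[OF ring_endo_kill_vars])

text \<open>
  A polynomial in \<open>J\<close> with non-zero constant coefficient differs from a unit by an element of \<open>J\<close>.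
\<close>

lemma var_ideal_maximal:
  assumes J: "ideal J R" and sub: "var_ideal \<subseteq> J"
  shows "J = var_ideal \<or> 1 \<in> J"
proof (rule disjCI)
  assume 1: "1 \<notin> J"
  have "p \<in> var_ideal" if p: "p \<in> J" for p
  proof -
    have pS: "p \<in> S" using ideal_subset[OF J p] .
    define c where "c = Poly_Mapping.lookup p 0"
    have c: "kill_vars (verts G) p = Poly_Mapping.single 0 c"
      unfolding c_def by (rule kill_vars_all[OF pS])
    have "p - Poly_Mapping.single 0 c \<in> var_ideal"
      unfolding var_ideal_iff using pS
      by (simp add: diff_mem single_mem ring_endo_simps(6)[OF ring_endo_kill_vars] c kill_vars_single)
    then have "Poly_Mapping.single 0 c \<in> J"
      using ideal_diff[OF J p, of "p - Poly_Mapping.single 0 c"] sub by auto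
    then have "Poly_Mapping.single 0 (inverse c) * Poly_Mapping.single 0 c \<in> J"
      by (rule ideal_mult[OF J]) (simp add: single_mem)
    then have "c = 0"
      using 1 by (cases "c = 0") (simp_all add: mult_single)
    then show ?thesis using c pS by (simp add: var_ideal_iff)
  qed
  then show "J = var_ideal" using sub by auto
qed

lemma edge_ideal_subset_kill_cover:
  assumes "\<And>e. e \<in> edges G \<Longrightarrow> e \<inter> C \<noteq> {}"
  shows "I \<subseteq> {p \<in> S. kill_vars C p = 0}"
proof (rule edge_ideal_minimal[OF ideal_kill_vars])
  fix a b assume ab: "{a, b} \<in> edges G"
  then show "variable a * variable b \<in> {p \<in> S. kill_vars C p = 0}"
    using assms[OF ab] edge_verts[OF ab]
    by (auto simp: mult_mem variable_mem kill_vars_mult kill_vars_variable)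
qed

lemma edge_ideal_subset_var_ideal: "I \<subseteq> var_ideal"
  by (rule edge_ideal_minimal[OF ideal_var_ideal])
    (auto dest!: edge_verts intro!: ideal_mult[OF ideal_var_ideal] x_in_var_ideal variable_mem)

lemma koszul_retract_kill_var: "u \<in> verts G \<Longrightarrow> koszul_retract S (verts G) variable rank u (kill_vars {u})"
  by (intro koszul_retract.intro koszul_complex_axioms koszul_retract_axioms.intro
      ring_endo_kill_vars kill_vars_congruent kill_vars_mem) (auto simp: kill_vars_variable)

lemma acyclic_colon_variables:
  assumes "finite T" "T \<subseteq> verts G" and ac: "\<And>i. n \<le> i \<Longrightarrow> acyclic I i" and "n \<le> i"
  shows "acyclic (colon I (\<Prod>v\<in>T. variable v)) i"
  using assms(1,2,4)
proof (induction T arbitrary: i rule: finite_induct)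
  case empty
  have "colon I 1 = I" using ideal_subset[OF ideal_edge_ideal] by (auto simp: colon_def)
  then show ?case using ac empty by simp
next
  case (insert u T)
  interpret koszul_retract S "verts G" variable rank u "kill_vars {u}"
    using insert.prems by (intro koszul_retract_kill_var) auto
  let ?y = "\<Prod>v\<in>T. variable v :: ('v, 'k) mvpoly"
  have y: "?y \<in> S" using insert.prems by (intro prod_mem variable_mem) auto
  have ky: "kill_vars {u} ?y = ?y"
    using insert.hyps(2) by (intro kill_vars_prod_variable) auto
  have "acyclic (colon (colon I ?y) (variable u)) i"
  proof (rule acyclic_colon)
    show "ideal (colon I ?y) R" by (rule ideal_colon[OF ideal_edge_ideal y])
    show "kill_vars {u} s \<in> colon I ?y" if "s \<in> colon I ?y" for s
      using that kill_vars_edge_ideal[of "s * ?y" "{u}"]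
      by (simp add: colon_def kill_vars_mem kill_vars_mult ky)
    show "acyclic (colon I ?y) i" "acyclic (colon I ?y) (Suc i)"
      using insert.prems by (auto intro: insert.IH)
  qed
  moreover have "colon (colon I ?y) (variable u) = colon I (\<Prod>v\<in>insert u T. variable v)"
    using insert.hyps insert.prems variable_mem[of u "verts G"]
    by (auto simp: colon_def mult.assoc intro: mult_mem)
  ultimately show ?case by simp
qed

text \<open>
  If the homology vanished from degree \<open>|C|\<close> on, then it would vanish in degree \<open>|C|\<close> for
  \<open>J = I : \<Prod>(V - C)\<close>. As every vertex of \<open>C\<close> has a neighbour outside \<open>C\<close>, all variables in \<open>C\<close> lie in \<open>J\<close>,
  so the basis element \<open>e\<^sub>C\<close> is a cycle modulo \<open>J\<close>. It is not a boundary, since the coefficients of a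
  boundary lie in the ideal of the variables, which contains \<open>J\<close> but not 1.
\<close>

lemma not_acyclic_of_minimal_cover:
  assumes C: "C \<subseteq> verts G" and cover: "\<And>e. e \<in> edges G \<Longrightarrow> e \<inter> C \<noteq> {}"
    and minimal: "\<And>a. a \<in> C \<Longrightarrow> \<exists>b\<in>verts G - C. {a, b} \<in> edges G"
  shows "\<exists>i\<ge>card C. \<not> acyclic I i"
proof (rule ccontr)
  assume "\<not> ?thesis"
  then have all: "\<And>i. card C \<le> i \<Longrightarrow> acyclic I i" by auto
  define T where "T = verts G - C"
  let ?y = "\<Prod>v\<in>T. variable v :: ('v, 'k) mvpoly"
  let ?J = "colon I ?y"
  have T: "finite T" "T \<subseteq> verts G" "T \<inter> C = {}" using finite_V by (auto simp: T_def)
  have y: "?y \<in> S" using T by (intro prod_mem variable_mem) auto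
  have J: "ideal ?J R" by (rule ideal_colon[OF ideal_edge_ideal y])
  have ac: "acyclic ?J (card C)" using T all by (intro acyclic_colon_variables) auto
  have vJ: "variable a \<in> ?J" if a: "a \<in> C" for a
  proof -
    obtain b where b: "b \<in> T" "{a, b} \<in> edges G" using minimal[OF a] by (auto simp: T_def)
    have "variable a * ?y = (\<Prod>v\<in>T - {b}. variable v) * (variable a * variable b)"
      using b(1) T(1) by (simp add: prod.remove mult_ac)
    also have "\<dots> \<in> I"
      using T(2) by (intro ideal_mult[OF ideal_edge_ideal] edge_mem b(2) prod_mem variable_mem) auto
    finally show ?thesis using a C by (auto simp: colon_def variable_mem)
  qed
  define c :: "'v set \<Rightarrow> ('v, 'k) mvpoly" where "c \<sigma> = (if \<sigma> = C then 1 else 0)" for \<sigma>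
  obtain b where b: "\<And>\<sigma>. b \<sigma> \<in> S"
    and cb: "\<And>\<sigma>. \<sigma> \<subseteq> verts G \<Longrightarrow> card \<sigma> = card C \<Longrightarrow> c \<sigma> - bd b \<sigma> \<in> ?J"
  proof (rule acyclicE[OF ac, of c])
    show "c \<sigma> \<in> S" for \<sigma> by (simp add: c_def one_mem zero_mem)
    fix \<tau> assume \<tau>: "\<tau> \<subseteq> verts G" "Suc (card \<tau>) = card C"
    show "bd c \<tau> \<in> ?J"
      unfolding koszul_boundary_def
    proof (rule ideal_sum[OF J])
      fix v assume "v \<in> verts G - \<tau>"
      show "sg v \<tau> * variable v * c (insert v \<tau>) \<in> ?J"
      proof (cases "insert v \<tau> = C")
        case True
        then have "variable v \<in> ?J" using vJ by auto
        then show ?thesis using True by (simp add: c_def ideal_mult[OF J _ sg_mem])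
      qed (simp add: c_def ideal_zero[OF J])
    qed
  qed blast
  have "?J \<subseteq> var_ideal"
  proof
    fix r assume "r \<in> ?J"
    then have r: "r \<in> S" "r * ?y \<in> I" by (auto simp: colon_def)
    have "kill_vars C (r * ?y) = 0"
      using edge_ideal_subset_kill_cover[OF cover] r(2) by auto
    moreover have "kill_vars C ?y = ?y"
      using T(3) by (rule kill_vars_prod_variable)
    ultimately have "kill_vars C r = 0"
      using mvpoly_no_zero_divisors[OF _ prod_variable_nonzero] by (metis kill_vars_mult)
    then have "kill_vars (verts G) r = 0"
      using kill_vars_kill_vars[of "verts G" C r] C by (simp add: Un_absorb2 kill_vars_zero)
    then show "r \<in> var_ideal" using r(1) by (simp add: var_ideal_iff)
  qed
  then have "1 - bd b C \<in> var_ideal" using cb[OF C refl] by (auto simp: c_def)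
  moreover have "bd b C \<in> var_ideal"
    unfolding koszul_boundary_def
    by (intro ideal_sum[OF ideal_var_ideal] ideal_mult_right[OF ideal_var_ideal]
        ideal_mult[OF ideal_var_ideal] sg_mem x_in_var_ideal b) auto
  ultimately have "1 \<in> var_ideal" by (rule ideal_diff_cancel[OF ideal_var_ideal])
  then show False using one_notin_var_ideal by simp
qed

end

section \<open>Depth and height of the graded maximal ideal\<close>

context edge_ring_of
begin

abbreviation residue :: "('v, 'k) mvpoly \<Rightarrow> ('v, 'k) mvpoly set" where
  "residue \<equiv> (+>\<^bsub>R\<^esub>) I"

interpretation I: ideal I R
  by (rule ideal_edge_ideal)

lemma edge_ring_eq: "edge_ring K G = R Quot I"
  by (simp add: edge_ring_def polynomial_ring_eq)

lemma edge_ideal_Un_variables: "genideal R (I \<union> variable ` verts G) = var_ideal"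
proof
  have sub: "I \<union> variable ` verts G \<subseteq> carrier R"
    using ideal_subset[OF ideal_edge_ideal] variable_mem by auto
  show "genideal R (I \<union> variable ` verts G) \<subseteq> var_ideal"
    using edge_ideal_subset_var_ideal x_in_var_ideal
    by (intro ring_R.genideal_minimal ideal_var_ideal) auto
  show "var_ideal \<subseteq> genideal R (I \<union> variable ` verts G)"
    using ring_R.genideal_self[OF sub]
    by (intro var_ideal_minimal ring_R.genideal_ideal[OF sub]) auto
qed

lemma residue_in_max_ideal_iff:
  assumes "p \<in> S"
  shows "residue p \<in> edge_ring_max_ideal K G \<longleftrightarrow> p \<in> var_ideal"
proof -
  have "(\<lambda>v. residue (variable v)) ` verts G = residue ` variable ` verts G"
    by (simp add: image_image)
  moreover have "variable ` verts G \<subseteq> carrier R" using variable_mem by auto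
  ultimately show ?thesis
    using I.quot_genideal_iff[of "variable ` verts G" p] assms
    by (simp add: edge_ring_max_ideal_def edge_ring_eq polynomial_ring_eq edge_ideal_Un_variables)
qed

lemma edge_ring_max_ideal_eq: "edge_ring_max_ideal K G = residue ` var_ideal"
proof
  have "edge_ring_max_ideal K G \<subseteq> carrier (R Quot I)"
  proof -
    have "(\<lambda>v. residue (variable v)) ` verts G \<subseteq> carrier (R Quot I)"
      by (auto simp: I.quot_carrier intro!: imageI variable_mem)
    from ring.genideal_ideal[OF I.quotient_is_ring this] show ?thesis
      unfolding edge_ring_max_ideal_def edge_ring_eq polynomial_ring_eq
      by (rule additive_subgroup.a_subset[OF ideal.axioms(1)])
  qed
  then show "edge_ring_max_ideal K G \<subseteq> residue ` var_ideal"
    using residue_in_max_ideal_iff by (fastforce simp: I.quot_carrier)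
  show "residue ` var_ideal \<subseteq> edge_ring_max_ideal K G"
    using residue_in_max_ideal_iff ideal_subset[OF ideal_var_ideal] by auto
qed

lemma regular_sequence_edge_ring_iff:
  assumes "set fs \<subseteq> var_ideal"
  shows "regular_sequence (R Quot I) (map residue fs) \<longleftrightarrow> regular_seq_on I fs"
proof -
  have fs: "set fs \<subseteq> S" using assms ideal_subset[OF ideal_var_ideal] by auto
  have "genideal R (I \<union> set fs) \<subseteq> var_ideal"
    using assms edge_ideal_subset_var_ideal by (intro ring_R.genideal_minimal ideal_var_ideal) auto
  then have "genideal R (I \<union> set fs) \<noteq> S"
    using one_notin_var_ideal one_mem by auto
  then show ?thesis
    by (simp add: regular_sequence_quot_iff[OF ideal_edge_ideal fs])
qed

lemma edge_ring_depth_eq: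
  "edge_ring_depth K G = Sup {enat (length fs) | fs. set fs \<subseteq> var_ideal \<and> regular_seq_on I fs}"
proof -
  have "{enat (length xs) | xs. regular_sequence (R Quot I) xs \<and> set xs \<subseteq> residue ` var_ideal} =
      {enat (length fs) | fs. set fs \<subseteq> var_ideal \<and> regular_seq_on I fs}" (is "?A = ?B")
  proof
    show "?A \<subseteq> ?B"
    proof
      fix n assume "n \<in> ?A"
      then obtain xs where n: "n = enat (length xs)" and xs: "regular_sequence (R Quot I) xs"
        and sub: "set xs \<subseteq> residue ` var_ideal" by auto
      have "\<exists>fs. set fs \<subseteq> var_ideal \<and> xs = map residue fs"
        using sub
      proof (induction xs)
        case (Cons a xs)
        then obtain f fs where "f \<in> var_ideal" "a = residue f" "set fs \<subseteq> var_ideal" "xs = map residue fs"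
          by auto
        then show ?case by (intro exI[of _ "f # fs"]) auto
      qed simp
      then obtain fs where "set fs \<subseteq> var_ideal" "xs = map residue fs" by auto
      then show "n \<in> ?B" using n xs regular_sequence_edge_ring_iff by auto
    qed
    show "?B \<subseteq> ?A"
    proof
      fix n assume "n \<in> ?B"
      then obtain fs where "n = enat (length fs)" "set fs \<subseteq> var_ideal" "regular_seq_on I fs" by auto
      then show "n \<in> ?A"
        using regular_sequence_edge_ring_iff[of fs] by (intro CollectI exI[of _ "map residue fs"]) auto
    qed
  qed
  then show ?thesis
    by (simp add: edge_ring_depth_def depth_def edge_ring_eq edge_ring_max_ideal_eq)
qed

text \<open>
  A supremum of extended naturals that is at least a finite \<open>d\<close> is reached or exceeded by a member.
\<close>

lemma acyclic_of_le_depth: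
  assumes d: "enat d \<le> edge_ring_depth K G" and i: "card (verts G) < i + d"
  shows "acyclic I i"
proof -
  have "\<exists>fs. set fs \<subseteq> var_ideal \<and> regular_seq_on I fs \<and> d \<le> length fs"
  proof (cases d)
    case (Suc k)
    show ?thesis
    proof (rule ccontr)
      assume "\<not> ?thesis"
      then have "length fs \<le> k" if "set fs \<subseteq> var_ideal" "regular_seq_on I fs" for fs
        using that Suc by (metis not_less_eq_eq)
      then have "edge_ring_depth K G \<le> enat k"
        unfolding edge_ring_depth_eq by (intro Sup_least) auto
      then show False using order_trans[OF d] Suc by fastforce
    qed
  qed (auto intro: exI[of _ "[]"])
  then obtain fs where "set fs \<subseteq> var_ideal" "regular_seq_on I fs" "d \<le> length fs" by auto
  then show ?thesis
    using i by (intro acyclic_of_regular_seq[OF ideal_edge_ideal]) auto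
qed

lemma le_depth_of_acyclic:
  assumes "ideal_maximum_condition I" and "\<And>i. card (verts G) < i + d \<Longrightarrow> acyclic I i"
  shows "enat d \<le> edge_ring_depth K G"
proof -
  obtain fs where "length fs = d" "set fs \<subseteq> var_ideal" "regular_seq_on I fs"
    using regular_seq_of_acyclic[OF assms(1) one_notin_var_ideal ideal_edge_ideal order_refl
        edge_ideal_subset_var_ideal assms(2)] by auto
  then show ?thesis
    unfolding edge_ring_depth_eq by (intro Sup_upper) auto
qed

lemma depth_le_minimal_cover:
  assumes C: "C \<subseteq> verts G" and "\<And>e. e \<in> edges G \<Longrightarrow> e \<inter> C \<noteq> {}"
    and "\<And>a. a \<in> C \<Longrightarrow> \<exists>b\<in>verts G - C. {a, b} \<in> edges G"
  shows "edge_ring_depth K G \<le> enat (card (verts G - C))"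
proof (rule ccontr)
  assume "\<not> ?thesis"
  then have d: "enat (Suc (card (verts G - C))) \<le> edge_ring_depth K G"
    by (simp add: Suc_ile_eq)
  obtain i where i: "card C \<le> i" "\<not> acyclic I i"
    using not_acyclic_of_minimal_cover[OF assms] by auto
  have "card (verts G) = card (verts G - C) + card C"
    using C finite_V finite_subset[OF C finite_V] by (simp add: card_Diff_subset card_mono)
  then have "card (verts G) < i + Suc (card (verts G - C))" using i(1) by simp
  from acyclic_of_le_depth[OF d this] show False using i(2) by simp
qed

lemma maximalideal_edge_ring: "maximalideal (edge_ring_max_ideal K G) (edge_ring K G)"
  unfolding edge_ring_max_ideal_eq edge_ring_eq
  by (rule maximalideal_quot_image[OF ideal_edge_ideal ideal_var_ideal one_notin_var_ideal
        edge_ideal_subset_var_ideal var_ideal_maximal])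

text \<open>
  The chain starts with the prime ideal generated by \<open>C\<close> and adds the other variables one by one.
\<close>

lemma cover_le_height:
  assumes C: "C \<subseteq> verts G" and cover: "\<And>e. e \<in> edges G \<Longrightarrow> e \<inter> C \<noteq> {}"
  shows "enat (card (verts G - C)) \<le> height (edge_ring K G) (edge_ring_max_ideal K G)"
proof -
  obtain ws where ws: "set ws = verts G - C" "distinct ws"
    using finite_distinct_list finite_V by (metis finite_Diff)
  define n where "n = length ws"
  have n: "card (verts G - C) = n" using distinct_card[OF ws(2)] ws(1) by (simp add: n_def)
  define W where "W j = C \<union> set (take j ws)" for j
  define Q where "Q j = {p \<in> S. kill_vars (W j) p = 0}" for j
  have IQ: "I \<subseteq> Q j" for j
    unfolding Q_def W_def
    by (rule edge_ideal_subset_kill_cover) (use cover in blast)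
  have Qi: "ideal (Q j) R" for j unfolding Q_def by (rule ideal_kill_vars)
  have QQ: "Q i \<subseteq> Q j" if "W i \<subseteq> W j" for i j
  proof
    fix p assume "p \<in> Q i"
    then have p: "p \<in> S" "kill_vars (W i) p = 0" by (auto simp: Q_def)
    have "kill_vars (W j) p = kill_vars (W j) (kill_vars (W i) p)"
      using that by (simp add: kill_vars_kill_vars Un_absorb2)
    then show "p \<in> Q j" using p by (simp add: Q_def kill_vars_zero)
  qed
  show ?thesis
    unfolding height_def n
  proof (intro Sup_upper CollectI exI[of _ n] conjI refl)
    show "\<exists>c. (\<forall>i\<le>n. primeideal (c i) (edge_ring K G)) \<and> (\<forall>i<n. c i \<subset> c (Suc i)) \<and>
        c n = edge_ring_max_ideal K G"
    proof (intro exI[of _ "\<lambda>j. residue ` Q j"] conjI allI impI)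
      show "primeideal (residue ` Q j) (edge_ring K G)" for j
        unfolding edge_ring_eq
        by (rule primeideal_quot_image[OF ideal_edge_ideal _ IQ])
          (simp add: Q_def primeideal_kill_vars)
      have "W n = verts G" using C ws(1) by (auto simp: W_def n_def)
      then have "Q n = var_ideal" by (auto simp: Q_def var_ideal_iff)
      then show "residue ` Q n = edge_ring_max_ideal K G" by (simp add: edge_ring_max_ideal_eq)
      fix j assume j: "j < n"
      let ?w = "ws ! j"
      have take: "take (Suc j) ws = take j ws @ [?w]"
        using j by (simp add: n_def take_Suc_conv_app_nth)
      have wV: "?w \<in> verts G - C" using j ws(1) nth_mem[of j ws] by (auto simp: n_def)
      have "?w \<notin> set (take j ws)"
        using ws(2) j distinct_take[OF ws(2), of "Suc j"] unfolding take by simp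
      then have w: "?w \<notin> W j" "?w \<in> W (Suc j)" using wV by (auto simp: W_def take)
      have wS: "variable ?w \<in> S" using wV by (auto intro: variable_mem)
      have "residue (variable ?w) \<in> residue ` Q (Suc j)"
        using w(2) wS by (intro imageI) (simp add: Q_def kill_vars_variable)
      moreover have "residue (variable ?w) \<notin> residue ` Q j"
        unfolding quot_image_iff[OF ideal_edge_ideal Qi IQ wS]
        using w(1) by (simp add: Q_def kill_vars_variable variable_nonzero)
      moreover have "Q j \<subseteq> Q (Suc j)"
        by (rule QQ) (auto simp: W_def take)
      ultimately show "residue ` Q j \<subset> residue ` Q (Suc j)" by blast
    qed
  qed
qed

end

section \<open>Deleting a leaf\<close>

lemma simple_graph_del_vertex: "simple_graph G \<Longrightarrow> simple_graph (del_vertex G u)"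
  by (auto simp: simple_graph_def del_vertex_def)

lemma edges_del_vertex:
  "simple_graph G \<Longrightarrow> {a, b} \<in> edges (del_vertex G u) \<longleftrightarrow> {a, b} \<in> edges G \<and> a \<noteq> u \<and> b \<noteq> u"
  by (auto simp: simple_graph_def del_vertex_def)

text \<open>
  Substituting 0 for \<open>u\<close> maps the generators of \<open>I\<^sub>G\<close> to those of the edge ideal of \<open>G \<setminus> u\<close> or to 0.
\<close>

lemma edge_ideal_del_vertex:
  fixes G :: "'v sgraph"
  assumes G: "simple_graph G"
  shows "edge_ideal (del_vertex G u) = (edge_ideal G \<inter> poly_carrier (verts G - {u}) :: ('v, 'k::field) mvpoly set)"
proof -
  obtain rank :: "'v \<Rightarrow> nat" where r: "inj_on rank (verts G)"
    using G finite_imp_inj_to_nat_seg[of "verts G"] by (auto simp: simple_graph_def)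
  interpret G: edge_ring_of G "TYPE('k)" rank
    using G r by unfold_locales
  interpret D: edge_ring_of "del_vertex G u" "TYPE('k)" rank
    using simple_graph_del_vertex[OF G] inj_on_subset[OF r]
    by unfold_locales (auto simp: del_vertex_def)
  have V: "verts (del_vertex G u) = verts G - {u}" by (simp add: del_vertex_def)
  have mem: "s \<in> G.S" if "s \<in> poly_carrier (verts G - {u})" for s :: "('v, 'k) mvpoly"
    using that by (auto simp: poly_carrier_Diff)
  show ?thesis
  proof
    have "ideal (G.I \<inter> D.S) D.R"
      using G.ideal_zero[OF G.ideal_edge_ideal] G.ideal_add[OF G.ideal_edge_ideal]
        G.ideal_mult[OF G.ideal_edge_ideal] mem
      unfolding D.ideal_iff by (auto simp: V D.zero_mem[unfolded V] D.add_mem[unfolded V] D.mult_mem[unfolded V])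
    then have "D.I \<subseteq> G.I \<inter> D.S"
    proof (rule D.edge_ideal_minimal)
      fix a b assume ab: "{a, b} \<in> edges (del_vertex G u)"
      then show "variable a * variable b \<in> G.I \<inter> D.S"
        using edges_del_vertex[OF G] G.edge_mem D.edge_verts[OF ab]
        by (auto intro!: D.mult_mem variable_mem)
    qed
    then show "D.I \<subseteq> G.I \<inter> poly_carrier (verts G - {u})" by (simp add: V)
    have "G.I \<subseteq> {s \<in> G.S. kill_vars {u} s \<in> D.I}"
    proof (rule G.edge_ideal_minimal)
      show "ideal {s \<in> G.S. kill_vars {u} s \<in> D.I} G.R"
      proof (rule G.ideal_kill_vars_preimage[OF D.ideal_edge_ideal refl subring_poly_carrier])
        show "kill_vars {u} s \<in> D.S" if "s \<in> G.S" for s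
          using that by (simp add: V poly_carrier_Diff kill_vars_mem kill_vars_kill_vars)
      qed
      fix a b assume ab: "{a, b} \<in> edges G"
      then show "variable a * variable b \<in> {s \<in> G.S. kill_vars {u} s \<in> D.I}"
        using G.edge_verts[OF ab] D.edge_mem[of a b] edges_del_vertex[OF G, of a b u]
          D.ideal_zero[OF D.ideal_edge_ideal]
        by (auto simp: kill_vars_mult kill_vars_variable intro!: G.mult_mem variable_mem)
    qed
    then show "G.I \<inter> poly_carrier (verts G - {u}) \<subseteq> D.I"
      by (auto simp: poly_carrier_Diff)
  qed
qed

text \<open>
  Vanishing of Koszul homology passes to the retract in the same degrees, and one variable fewer
  shifts the corresponding depth by one.
\<close>

lemma depth_del_vertex_ge:
  fixes G :: "'v sgraph"
  assumes G: "simple_graph G" and u: "u \<in> verts G"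
    and noeth: "noetherian_ring (edge_ring TYPE('k::field) G)"
    and d: "enat (Suc d) \<le> edge_ring_depth TYPE('k) G"
  shows "enat d \<le> edge_ring_depth TYPE('k) (del_vertex G u)"
proof -
  obtain rank :: "'v \<Rightarrow> nat" where r: "inj_on rank (verts G)"
    using G finite_imp_inj_to_nat_seg[of "verts G"] by (auto simp: simple_graph_def)
  interpret G: edge_ring_of G "TYPE('k)" rank
    using G r by unfold_locales
  interpret D: edge_ring_of "del_vertex G u" "TYPE('k)" rank
    using simple_graph_del_vertex[OF G] inj_on_subset[OF r]
    by unfold_locales (auto simp: del_vertex_def)
  interpret K: koszul_retract G.S "verts G" variable rank u "kill_vars {u}"
    by (rule G.koszul_retract_kill_var[OF u])
  have V: "verts (del_vertex G u) = verts G - {u}" by (simp add: del_vertex_def)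
  have DS: "D.S = {s \<in> G.S. kill_vars {u} s = s}" by (simp add: V poly_carrier_Diff)
  have DI: "D.I = G.I \<inter> D.S" using edge_ideal_del_vertex[OF G] by (simp add: V)
  show ?thesis
  proof (rule D.le_depth_of_acyclic)
    have "G.ideal_maximum_condition G.I"
      using noeth G.maximum_condition_of_noetherian[OF G.ideal_edge_ideal] by (simp add: G.edge_ring_eq)
    then show "D.ideal_maximum_condition D.I"
      by (intro K.maximum_condition_retract[OF G.ideal_edge_ideal G.kill_vars_edge_ideal DS
            subring_poly_carrier DI])
    fix i assume i: "card (verts (del_vertex G u)) < i + d"
    have "card (verts G) = Suc (card (verts (del_vertex G u)))"
      by (simp only: V card_Suc_Diff1[OF G.finite_V u])
    then have "G.acyclic G.I i" using i by (intro G.acyclic_of_le_depth[OF d]) simp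
    then have "D.acyclic G.I i"
      using K.acyclic_restrict[OF G.ideal_edge_ideal G.kill_vars_edge_ideal] by (simp add: V poly_carrier_Diff)
    then show "D.acyclic D.I i"
      by (rule D.acyclic_cong[rotated]) (simp add: DI)
  qed
qed

theorem lemma3p1:
  fixes G :: "'v sgraph" and u v :: 'v
  assumes "simple_graph G"
    and "no_isolated_vertices G"
    and "bipartite G"
    and "cohen_macaulay_graph TYPE('k::field) G"
    and "leaf G u"
    and "nbhd G u = {v}"
    and "vertex_degree G v \<ge> 2"
  shows "edge_ring_depth TYPE('k) (del_vertex G u) + 1 = edge_ring_depth TYPE('k) G"
proof -
  note G = assms(1)
  obtain rank :: "'v \<Rightarrow> nat" where r: "inj_on rank (verts G)"
    using G finite_imp_inj_to_nat_seg[of "verts G"] by (auto simp: simple_graph_def)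
  interpret G: edge_ring_of G "TYPE('k)" rank
    using G r by unfold_locales
  interpret D: edge_ring_of "del_vertex G u" "TYPE('k)" rank
    using simple_graph_del_vertex[OF G] inj_on_subset[OF r]
    by unfold_locales (auto simp: del_vertex_def)
  have V: "verts (del_vertex G u) = verts G - {u}" by (simp add: del_vertex_def)
  have u: "u \<in> verts G" using assms(5) by (simp add: leaf_def)
  obtain A0 B0 where AB0: "A0 \<union> B0 = verts G" "A0 \<inter> B0 = {}"
    "\<forall>e\<in>edges G. \<exists>a\<in>A0. \<exists>b\<in>B0. e = {a, b}"
    using assms(3) by (auto simp: bipartite_def)
  \<comment> \<open>The bipartition is symmetric, so the leaf may be placed in the second part.\<close>
  obtain A B where AB: "A \<union> B = verts G" "A \<inter> B = {}"
    and bip: "\<And>e. e \<in> edges G \<Longrightarrow> \<exists>a\<in>A. \<exists>b\<in>B. e = {a, b}" and uB: "u \<in> B"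
  proof (cases "u \<in> B0")
    case True
    then show ?thesis using AB0 that[of A0 B0] by simp
  next
    case False
    then have "u \<in> A0" using u AB0(1) by auto
    moreover have "\<exists>a\<in>B0. \<exists>b\<in>A0. e = {a, b}" if "e \<in> edges G" for e
      using AB0(3) that by (metis insert_commute)
    ultimately show ?thesis using AB0(1,2) that[of B0 A0] by (simp add: Un_commute Int_commute)
  qed
  have cross: "a \<in> A \<longleftrightarrow> b \<in> B" if "{a, b} \<in> edges G" for a b
    using bip[OF that] AB(2) by (auto simp: doubleton_eq_iff)
  have neighbour: "\<exists>w. {a, w} \<in> edges G" if "a \<in> verts G" for a
  proof -
    have "nbhd G a \<noteq> {}" using assms(2) that by (simp add: no_isolated_vertices_def)
    then obtain w where "{w, a} \<in> edges G" by (auto simp: nbhd_def)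
    then show ?thesis by (auto simp: insert_commute[of w a])
  qed
  have VA: "verts G - A = B" using AB by auto
  have coverA: "e \<inter> A \<noteq> {}" if "e \<in> edges G" for e
    using bip[OF that] by auto
  have minA: "\<exists>b\<in>verts G - A. {a, b} \<in> edges G" if "a \<in> A" for a
    using neighbour[of a] cross that AB(1) unfolding VA by blast
  have CM: "noetherian_ring (edge_ring TYPE('k) G)"
    "edge_ring_depth TYPE('k) G = height (edge_ring TYPE('k) G) (edge_ring_max_ideal TYPE('k) G)"
    using assms(4) G.maximalideal_edge_ring
    by (auto simp: cohen_macaulay_graph_def cohen_macaulay_ring_def edge_ring_depth_def)
  have "A \<subseteq> verts G" "B \<subseteq> verts G" using AB(1) by auto
  have depth_B: "edge_ring_depth TYPE('k) G = enat (card B)"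
  proof (rule antisym)
    show "edge_ring_depth TYPE('k) G \<le> enat (card B)"
      using G.depth_le_minimal_cover[OF \<open>A \<subseteq> verts G\<close> coverA minA] by (simp add: VA)
    show "enat (card B) \<le> edge_ring_depth TYPE('k) G"
      using G.cover_le_height[OF \<open>A \<subseteq> verts G\<close> coverA] by (simp add: VA CM(2))
  qed
  have "finite B" using G.finite_V \<open>B \<subseteq> verts G\<close> finite_subset by blast
  obtain k where k: "card B = Suc k" "card (B - {u}) = k"
    using uB \<open>finite B\<close> by (metis card_Suc_Diff1)
  have u_edge: "w = v" if "{w, u} \<in> edges G" for w
    using that assms(6) by (auto simp: nbhd_def)
  have le: "edge_ring_depth TYPE('k) (del_vertex G u) \<le> enat k"
  proof -
    have AV: "A \<subseteq> verts (del_vertex G u)" using AB uB by (auto simp: V)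
    have "edge_ring_depth TYPE('k) (del_vertex G u) \<le> enat (card (verts (del_vertex G u) - A))"
    proof (rule D.depth_le_minimal_cover[OF AV])
      show "e \<inter> A \<noteq> {}" if "e \<in> edges (del_vertex G u)" for e
        using that coverA by (simp add: del_vertex_def)
      fix a assume a: "a \<in> A"
      \<comment> \<open>Only \<open>v\<close> loses a neighbour, and it has another one.\<close>
      have "\<exists>b. b \<noteq> u \<and> {a, b} \<in> edges G"
      proof (cases "a = v")
        case True
        have "\<not> nbhd G v \<subseteq> {u}"
          using assms(7) card_mono[of "{u}" "nbhd G v"] by (auto simp: vertex_degree_def)
        then obtain b where "b \<noteq> u" "{b, v} \<in> edges G" by (auto simp: nbhd_def)
        then show ?thesis using True by (auto simp: insert_commute[of b v])
      next
        case False
        obtain w where w: "{a, w} \<in> edges G" using neighbour[of a] a AB(1) by auto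
        moreover have "w \<noteq> u" using False u_edge[of a] w by auto
        ultimately show ?thesis by auto
      qed
      then obtain b where b: "b \<noteq> u" "{a, b} \<in> edges G" by auto
      have "b \<in> B" "a \<noteq> u" using cross[OF b(2)] a AB(2) uB by auto
      then show "\<exists>b\<in>verts (del_vertex G u) - A. {a, b} \<in> edges (del_vertex G u)"
        using b AB edges_del_vertex[OF G, of a b u] by (intro bexI[of _ b]) (auto simp: V)
    qed
    moreover have "verts (del_vertex G u) - A = B - {u}" using VA by (auto simp: V)
    ultimately show ?thesis using k(2) by simp
  qed
  have "enat k \<le> edge_ring_depth TYPE('k) (del_vertex G u)"
    using depth_B k(1) by (intro depth_del_vertex_ge[OF G u CM(1)]) simp
  then have "edge_ring_depth TYPE('k) (del_vertex G u) = enat k" using le by (rule antisym[rotated])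
  then show ?thesis by (simp add: depth_B k(1) one_enat_def)
qed

end
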